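(* Let $k$ be an algebraically closed field of characteristic $p\ne 2$, $G=SL_2$, and let $\mathcal{N}$ be the nilpotent cone of $\mathfrak{sl}_2$. For each $r>0$, we have $$\mathrm{ch}_t\,k[C_r(\mathcal{N})]=\sum_{n\ge 0}\ \sum_{a_1+\cdots+a_r=n}\chi(n\alpha)\,t^n,$$ where the inner sum is taken over all $r$-tuples $(a_1,\ldots,a_r)$ of non-negative integers satisfying $a_1+\cdots+a_r=n$.
   Context: $C_r(\mathcal{N})=\{(v_1,\ldots,v_r)\in\mathcal{N}^r\mid [v_i,v_j]=0\text{ for all }i,j\}$ with reduced structure; $k[C_r(\mathcal{N})]$ is a graded $G$-algebra, graded by polynomial degree (as a quotient of $k[\mathfrak{sl}_2^r]$ by a homogeneous ideal), with the $G$-action induced by the diagonal adjoint action. Fix a maximal torus $T\subset G$ and let $\alpha$ be the positive (simple) root; $B$ is the Borel subgroup containing $T$ corresponding to the negative root. For a graded $T$-module $V=\bigoplus_{n\ge 0}V_n$ with each $V_n$ finite dimensional, $\mathrm{ch}_tV=\sum_{n\ge 0}\mathrm{ch}(V_n)t^n$, where $\mathrm{ch}$ is the formal $T$-character. For a finite-dimensional $B$-module $M$, $\chi(M)=\sum_{i\ge 0}(-1)^i\,\mathrm{ch}\,\mathrm{H}^i(G/B,M)$, where $\mathrm{H}^i(G/B,M)=R^i\mathrm{ind}_B^G M$ is the cohomology of the homogeneous bundle on $G/B$ associated with $M$; for a weight $\lambda$, $\chi(\lambda)=\chi(k_\lambda)$ with $k_\lambda$ the one-dimensional $B$-module of weight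 $\lambda$. *)

theory Defs
  imports
    "HOL-Analysis.Analysis"
    "HOL-Computational_Algebra.Computational_Algebra"
    "HOL-Library.Function_Algebras"
    "HOL-Library.Poly_Mapping"
    "HOL-Library.Groups_Big_Fun"
begin

section \<open>Quotients of vector spaces\<close>

text \<open>\<open>S\<close> maps bijectively onto a basis of the quotient space \<open>V / W\<close>, where \<open>W \<subseteq> V\<close> are
  subspaces.\<close>

definition quot_basis ::
  "('k::field \<Rightarrow> 'v::ab_group_add \<Rightarrow> 'v) \<Rightarrow> 'v set \<Rightarrow> 'v set \<Rightarrow> 'v set \<Rightarrow> bool" where
  "quot_basis sc V W S \<longleftrightarrow>
     S \<subseteq> V \<and> V \<subseteq> module.span sc (W \<union> S) \<and>
     (\<forall>s\<in>S. s \<notin> module.span sc (W \<union> (S - {s})))"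

text \<open>As with \<^const>\<open>vector_space.dim\<close>, the value is \<open>0\<close> if \<open>V / W\<close> has infinite dimension.\<close>

definition dim_quot ::
  "('k::field \<Rightarrow> 'v::ab_group_add \<Rightarrow> 'v) \<Rightarrow> 'v set \<Rightarrow> 'v set \<Rightarrow> nat" where
  "dim_quot sc V W = card (SOME S. quot_basis sc V W S)"

definition fun_scale :: "('k \<Rightarrow> 'v \<Rightarrow> 'v) \<Rightarrow> 'k \<Rightarrow> ('p \<Rightarrow> 'v) \<Rightarrow> 'p \<Rightarrow> 'v" where
  "fun_scale sc c F = (\<lambda>x. sc c (F x))"

lemma vector_space_fun_scale:
  assumes "vector_space sc"
  shows "vector_space (fun_scale sc)"
proof -
  interpret vector_space sc by fact
  show ?thesis
    by unfold_locales
      (auto simp: fun_scale_def fun_eq_iff scale_right_distrib scale_left_distrib)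
qed

section \<open>Polynomial maps on closed subsets of affine space\<close>

text \<open>A closed subset \<open>X\<close> of an affine space is given by its set of \<open>k\<close>-points together with the
  set \<open>cs\<close> of coordinate functions of the affine space. For a vector space \<open>V\<close>, the polynomial
  maps \<open>X \<rightarrow> V\<close> form the space \<open>k[X] \<otimes> V\<close>; they are encoded as functions on the whole type that
  vanish outside \<open>X\<close>.\<close>

definition monomial_funs :: "('p \<Rightarrow> 'k::comm_ring_1) set \<Rightarrow> nat \<Rightarrow> ('p \<Rightarrow> 'k) set" where
  "monomial_funs cs d = {\<lambda>x. \<Prod>c\<leftarrow>zs. c x | zs. length zs = d \<and> set zs \<subseteq> cs}"

definition homogeneous_maps ::
  "('k::field \<Rightarrow> 'v::ab_group_add \<Rightarrow> 'v) \<Rightarrow> ('p \<Rightarrow> 'k) set \<Rightarrow> 'p set \<Rightarrow> nat \<Rightarrow> ('p \<Rightarrow> 'v) set" where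
  "homogeneous_maps sc cs X d =
     module.span (fun_scale sc)
       {\<lambda>x. if x \<in> X then sc (m x) v else 0 | m v. m \<in> monomial_funs cs d}"

definition regular_maps ::
  "('k::field \<Rightarrow> 'v::ab_group_add \<Rightarrow> 'v) \<Rightarrow> ('p \<Rightarrow> 'k) set \<Rightarrow> 'p set \<Rightarrow> ('p \<Rightarrow> 'v) set" where
  "regular_maps sc cs X =
     module.span (fun_scale sc) (\<Union>d. homogeneous_maps sc cs X d)"

section \<open>The group, the torus and formal characters\<close>

type_synonym 'k mat2 = "'k^2^2"

definition SL2 :: "'k::field mat2 set" where
  "SL2 = {g. det g = 1}"

definition torus :: "'k::field \<Rightarrow> 'k mat2" where
  "torus s = (\<chi> i j. if i = j then (if i = 1 then s else inverse s) else 0)"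

text \<open>\<open>T\<close> consists of the matrices \<^term>\<open>torus s\<close>, \<open>s \<noteq> 0\<close>. The weight \<open>l :: int\<close> stands for the
  character \<open>torus s \<mapsto> s powi l\<close>, and the positive root is the weight \<open>torus s \<mapsto> s\<^sup>2\<close> of
  \<open>T\<close> on the strictly upper triangular matrices.\<close>

definition pos_root :: int where
  "pos_root = 2"

text \<open>The negative root is the weight of \<open>T\<close> on the strictly lower triangular matrices, so the
  corresponding Borel subgroup is the lower triangular one.\<close>

definition Bneg :: "'k::field mat2 set" where
  "Bneg = {b \<in> SL2. b $ 1 $ 2 = 0}"

text \<open>The \<open>T\<close>-module is \<open>V / W\<close>, with action induced by \<open>act\<close>; the following is the preimage in
  \<open>V\<close> of the weight space of \<open>V / W\<close> for the weight \<open>l\<close>.\<close>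

definition weight_space ::
  "('k::field \<Rightarrow> 'v::ab_group_add \<Rightarrow> 'v) \<Rightarrow> ('k mat2 \<Rightarrow> 'v \<Rightarrow> 'v) \<Rightarrow> 'v set \<Rightarrow> 'v set \<Rightarrow> int \<Rightarrow> 'v set"
  where
  "weight_space sc act V W l =
     {v \<in> V. \<forall>s. s \<noteq> 0 \<longrightarrow> act (torus s) v - sc (s powi l) v \<in> W}"

text \<open>Characters are elements of the group ring of the weight lattice. The definition is meaningful
  only if finitely many weight spaces of \<open>V / W\<close> are nonzero.\<close>

definition ch ::
  "('k::field \<Rightarrow> 'v::ab_group_add \<Rightarrow> 'v) \<Rightarrow> ('k mat2 \<Rightarrow> 'v \<Rightarrow> 'v) \<Rightarrow> 'v set \<Rightarrow> 'v set \<Rightarrow> int \<Rightarrow>\<^sub>0 int"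
  where
  "ch sc act V W =
     Abs_poly_mapping (\<lambda>l. int (dim_quot sc (weight_space sc act V W l) W))"

definition ch_t ::
  "('k::field \<Rightarrow> 'v::ab_group_add \<Rightarrow> 'v) \<Rightarrow> ('k mat2 \<Rightarrow> 'v \<Rightarrow> 'v)
    \<Rightarrow> (nat \<Rightarrow> 'v set) \<Rightarrow> (nat \<Rightarrow> 'v set) \<Rightarrow> (int \<Rightarrow>\<^sub>0 int) fps" where
  "ch_t sc act V W = Abs_fps (\<lambda>n. ch sc act (V n) (W n))"

section \<open>Cohomology of homogeneous bundles on \<open>G/B\<close>\<close>

text \<open>Let \<open>M\<close> be a \<open>B\<close>-module with action \<open>rho\<close>. The standard resolution of \<open>M\<close> by injective
  \<open>B\<close>-modules consists of the modules \<open>Q\<^sup>n = Mor(B\<^sup>n\<^sup>+\<^sup>1, M)\<close> with the action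
  \<open>(b q)(b\<^sub>0, \<dots>, b\<^sub>n) = b q(b\<inverse>b\<^sub>0, \<dots>, b\<inverse>b\<^sub>n)\<close> and the differential given by the alternating
  sum over the omission of one argument. The derived functors \<open>R\<^sup>i ind\<close> at \<open>M\<close> are the cohomology
  of \<open>ind Q\<^sup>\<bullet>\<close>, where \<open>ind N = {f \<in> Mor(G, N). f(g b) = b\<inverse> f(g)}\<close> with \<open>G\<close> acting by left
  translation. Maps \<open>G \<rightarrow> Q\<^sup>n\<close> are written as maps \<open>G \<times> B\<^sup>n\<^sup>+\<^sup>1 \<rightarrow> M\<close>.\<close>

definition GB_points :: "nat \<Rightarrow> ('k::field mat2 \<times> 'k mat2 list) set" where
  "GB_points n = SL2 \<times> {bs. length bs = Suc n \<and> set bs \<subseteq> Bneg}"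

text \<open>No inverse of the determinant or of the diagonal entries of \<open>B\<close> is needed here, since all
  determinants are \<open>1\<close>.\<close>

definition GB_coords :: "nat \<Rightarrow> ('k::field mat2 \<times> 'k mat2 list \<Rightarrow> 'k) set" where
  "GB_coords n =
     {\<lambda>(g, bs). g $ i $ j | i j. True} \<union> {\<lambda>(g, bs). bs ! l $ i $ j | l i j. l \<le> n}"

definition ind_cochains ::
  "('k::field \<Rightarrow> 'v::ab_group_add \<Rightarrow> 'v) \<Rightarrow> ('k mat2 \<Rightarrow> 'v \<Rightarrow> 'v) \<Rightarrow> nat
    \<Rightarrow> ('k mat2 \<times> 'k mat2 list \<Rightarrow> 'v) set" where
  "ind_cochains sc rho n =
     {F \<in> regular_maps sc (GB_coords n) (GB_points n).
        \<forall>(g, bs) \<in> GB_points n. \<forall>b \<in> Bneg.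
          F (g ** b, bs) = rho (matrix_inv b) (F (g, map (\<lambda>x. b ** x) bs))}"

definition ind_diff ::
  "nat \<Rightarrow> ('k::field mat2 \<times> 'k mat2 list \<Rightarrow> 'v::ab_group_add) \<Rightarrow> 'k mat2 \<times> 'k mat2 list \<Rightarrow> 'v" where
  "ind_diff n F = (\<lambda>(g, bs).
     if (g, bs) \<in> GB_points (Suc n) then
       \<Sum>i\<le>Suc n. (if even i then F (g, take i bs @ drop (Suc i) bs)
                    else - F (g, take i bs @ drop (Suc i) bs))
     else 0)"

definition ind_cocycles ::
  "('k::field \<Rightarrow> 'v::ab_group_add \<Rightarrow> 'v) \<Rightarrow> ('k mat2 \<Rightarrow> 'v \<Rightarrow> 'v) \<Rightarrow> nat
    \<Rightarrow> ('k mat2 \<times> 'k mat2 list \<Rightarrow> 'v) set" where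
  "ind_cocycles sc rho n = {F \<in> ind_cochains sc rho n. ind_diff n F = 0}"

definition ind_coboundaries ::
  "('k::field \<Rightarrow> 'v::ab_group_add \<Rightarrow> 'v) \<Rightarrow> ('k mat2 \<Rightarrow> 'v \<Rightarrow> 'v) \<Rightarrow> nat
    \<Rightarrow> ('k mat2 \<times> 'k mat2 list \<Rightarrow> 'v) set" where
  "ind_coboundaries sc rho n =
     (case n of 0 \<Rightarrow> {0} | Suc m \<Rightarrow> ind_diff m ` ind_cochains sc rho m)"

definition left_translation ::
  "'k::field mat2 \<Rightarrow> ('k mat2 \<times> 'k mat2 list \<Rightarrow> 'v) \<Rightarrow> 'k mat2 \<times> 'k mat2 list \<Rightarrow> 'v" where
  "left_translation h F = (\<lambda>(g, bs). F (matrix_inv h ** g, bs))"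

definition ch_H ::
  "('k::field \<Rightarrow> 'v::ab_group_add \<Rightarrow> 'v) \<Rightarrow> ('k mat2 \<Rightarrow> 'v \<Rightarrow> 'v) \<Rightarrow> nat \<Rightarrow> int \<Rightarrow>\<^sub>0 int" where
  "ch_H sc rho i =
     ch (fun_scale sc) left_translation (ind_cocycles sc rho i) (ind_coboundaries sc rho i)"

definition euler_char ::
  "('k::field \<Rightarrow> 'v::ab_group_add \<Rightarrow> 'v) \<Rightarrow> ('k mat2 \<Rightarrow> 'v \<Rightarrow> 'v) \<Rightarrow> int \<Rightarrow>\<^sub>0 int" where
  "euler_char sc rho = Sum_any (\<lambda>i. (-1) ^ i * ch_H sc rho i)"

text \<open>A weight is extended to \<open>B\<close> trivially on the unipotent radical.\<close>

definition chi :: "'k::field itself \<Rightarrow> int \<Rightarrow> int \<Rightarrow>\<^sub>0 int" where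
  "chi _ l = euler_char ((*) :: 'k \<Rightarrow> 'k \<Rightarrow> 'k) (\<lambda>b z. (b $ 1 $ 1) powi l * z)"

section \<open>Nilpotent commuting varieties\<close>

definition sl2 :: "'k::field mat2 set" where
  "sl2 = {X. trace X = 0}"

text \<open>The type class power \<open>X ^ m\<close> on vectors would be the entrywise one.\<close>

definition nilpotent_cone :: "'k::field mat2 set" where
  "nilpotent_cone = {X \<in> sl2. \<exists>m. ((\<lambda>Y. X ** Y) ^^ m) (mat 1) = 0}"

definition nilpotent_commuting_variety :: "nat \<Rightarrow> 'k::field mat2 list set" where
  "nilpotent_commuting_variety r =
     {vs. length vs = r \<and> set vs \<subseteq> nilpotent_cone \<and>
          (\<forall>i<r. \<forall>j<r. vs ! i ** vs ! j - vs ! j ** vs ! i = 0)}"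

text \<open>The component of degree \<open>n\<close> of \<open>k[sl\<^sub>2\<^sup>r]\<close>.\<close>

definition sl2_polys :: "nat \<Rightarrow> nat \<Rightarrow> ('k::field mat2 list \<Rightarrow> 'k) set" where
  "sl2_polys r n =
     homogeneous_maps (*) {\<lambda>vs. vs ! l $ i $ j | l i j. l < r}
       {vs. length vs = r \<and> set vs \<subseteq> sl2} n"

text \<open>The component of degree \<open>n\<close> of the ideal of the nilpotent commuting variety, so that the
  quotient of the previous space by this one is the component of degree \<open>n\<close> of its coordinate
  ring.\<close>

definition commuting_ideal :: "nat \<Rightarrow> nat \<Rightarrow> ('k::field mat2 list \<Rightarrow> 'k) set" where
  "commuting_ideal r n = {f \<in> sl2_polys r n. \<forall>vs \<in> nilpotent_commuting_variety r. f vs = 0}"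

definition adjoint_action :: "'k::field mat2 \<Rightarrow> ('k mat2 list \<Rightarrow> 'k) \<Rightarrow> 'k mat2 list \<Rightarrow> 'k" where
  "adjoint_action g f = (\<lambda>vs. f (map (\<lambda>X. matrix_inv g ** X ** g) vs))"

definition ch_t_commuting :: "'k::field itself \<Rightarrow> nat \<Rightarrow> (int \<Rightarrow>\<^sub>0 int) fps" where
  "ch_t_commuting _ r =
     ch_t (fun_scale (*)) adjoint_action (sl2_polys r :: nat \<Rightarrow> ('k mat2 list \<Rightarrow> 'k) set)
       (commuting_ideal r)"

end

(*
  Every point of C_r(N) has the form (c_1 M(x,y), ..., c_r M(x,y)) with M(x,y) the rank one
  nilpotent matrix with rows (xy, -x^2) and (y^2, -xy).  Pulling back along (x, y, c), the degree n
  part of the coordinate ring becomes the span of the monomials x^(2n-i) y^i c^a with |a| = n, whose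
  weights are those of H^0(n alpha), once for each a.

  On the other side, let u and v be the entries of the second column of g.  Away from u = 0 (and
  likewise v = 0) the cochain complex has a contracting homotopy, so for a cocycle F of positive
  degree, u^N F and v^N F bound for large N.  As (u, v) is unimodular on G, the Koszul complex of
  u^N and v^N is exact on cochains, and the obstruction to dividing by (u^N, v^N) is a cocycle of
  weight l + 2N in one degree less: in degree 0 it is a polynomial in u and v of degree at least 2N,
  hence in the ideal (u^N, v^N); in positive degree it becomes a coboundary after a further power.
*)

theory Submission
  imports Defs
begin

section \<open>Dimensions and characters from weight bases\<close>

text \<open>Since \<open>G/B\<close> is projective, it has no nonzero sections of negative weight,
  so functions of \<open>g\<close> alone cannot give a partition of unity for u and v. Cochains can,
  because they also depend on b_0. The coefficients are not cocycles, however, and this is why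
  exactness on cochains leaves a connecting obstruction that has to be treated separately. The bound
  2N on its degree is where nonnegativity of the weight enters: a monomial in u and v with both
  exponents below N has degree at most 2N - 2, and for weights at most -2 such monomials produce a
  nonzero H^1. The homotopy works at every weight, so the vanishing is proved without induction on
  the cohomological degree. Characters are defined through chosen bases of quotients of weight
  spaces. Each side is therefore matched with an indexed family of torus eigenvectors. Algebraic
  closedness enters by making k infinite: one torus element then separates finitely many weights,
  and identities between values become identities between coefficients.\<close>

lemma infinite_UNIV_alg_closed: "infinite (UNIV :: 'k::alg_closed_field set)"
proof
  assume fin: "finite (UNIV :: 'k set)"
  define P :: "'k poly" where "P = (\<Prod>a\<in>UNIV. [:- a, 1:]) + 1"
  have deg: "degree (\<Prod>a\<in>(UNIV :: 'k set). [:- a, 1:]) = card (UNIV :: 'k set)"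
    by (subst degree_prod_eq_sum_degree) auto
  have pos: "card (UNIV :: 'k set) > 0"
    using fin by (simp add: finite_UNIV_card_ge_0)
  have "degree P = card (UNIV :: 'k set)"
    unfolding P_def using deg pos by (subst degree_add_eq_left) auto
  then obtain x where "poly P x = 0"
    using pos alg_closed_imp_poly_has_root[of P] by auto
  moreover have "poly P x = 1"
    using fin by (auto simp: P_def poly_prod)
  ultimately show False by simp
qed

lemma poly_eqI_infinite:
  fixes p q :: "'k::idom poly"
  assumes "infinite A" "\<And>x. x \<in> A \<Longrightarrow> poly p x = poly q x"
  shows "p = q"
proof (rule ccontr)
  assume "p \<noteq> q"
  then have "finite {x. poly (p - q) x = 0}"
    by (intro poly_roots_finite) auto
  moreover have "A \<subseteq> {x. poly (p - q) x = 0}"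
    using assms(2) by auto
  ultimately show False
    using assms(1) finite_subset by blast
qed

lemma sum_monom_eq_zeroD:
  fixes c :: "nat \<Rightarrow> 'k::idom"
  assumes "infinite (UNIV :: 'k set)" "finite I" "\<And>z. (\<Sum>i\<in>I. c i * z ^ i) = 0" "i \<in> I"
  shows "c i = 0"
proof -
  have "(\<Sum>i\<in>I. monom (c i) i) = 0"
    by (rule poly_eqI_infinite[OF assms(1)]) (use assms(3) in \<open>simp add: poly_sum poly_monom\<close>)
  then have "coeff (\<Sum>i\<in>I. monom (c i) i) i = 0" by simp
  then show ?thesis
    using assms(2,4) by (simp add: coeff_sum if_distrib cong: if_cong)
qed

text \<open>A coincidence \<open>s powi m = s powi m'\<close> with m < m' makes s a root of X^(m' -
  m) - 1. Finitely many such polynomials have finitely many roots, and an infinite field has a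
  nonzero element outside all of them.\<close>

lemma exists_separating_scalar:
  fixes M :: "int set"
  assumes "infinite (UNIV :: 'k::field set)" "finite M"
  obtains s :: "'k::field" where "s \<noteq> 0" "\<And>m m'. m \<in> M \<Longrightarrow> m' \<in> M \<Longrightarrow> s powi m = s powi m' \<Longrightarrow> m = m'"
proof -
  define R :: "nat \<Rightarrow> 'k set" where "R n = {s. poly (monom 1 n - 1) s = 0}" for n
  have finR: "finite (R n)" if "n > 0" for n
  proof -
    have "coeff (monom 1 n - 1 :: 'k poly) n \<noteq> 0"
      using that by simp
    then have "(monom 1 n - 1 :: 'k poly) \<noteq> 0"
      by (metis coeff_0)
    then show ?thesis
      unfolding R_def by (rule poly_roots_finite)
  qed
  define B where "B = insert 0 (\<Union>(m, m') \<in> {(m, m'). m \<in> M \<and> m' \<in> M \<and> m < m'}. R (nat (m' - m)))"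
  have "finite {(m, m'). m \<in> M \<and> m' \<in> M \<and> m < m'}"
    by (rule finite_subset[of _ "M \<times> M"]) (use assms(2) in auto)
  then have "finite B"
    unfolding B_def using finR by auto
  then obtain s where s: "s \<notin> B"
    using assms(1) ex_new_if_finite by blast
  then have s0: "s \<noteq> 0"
    by (auto simp: B_def)
  have "s powi m \<noteq> s powi m'" if "m \<in> M" "m' \<in> M" "m < m'" for m m'
  proof
    assume eq: "s powi m = s powi m'"
    have "s powi m' = s powi m * s powi (m' - m)"
      using s0 by (simp flip: power_int_add)
    then have "s powi (m' - m) = 1"
      using eq s0 by simp
    then have "s ^ nat (m' - m) = 1"
      using that(3) by (simp add: power_int_def)
    then have "s \<in> R (nat (m' - m))"
      by (simp add: R_def poly_monom)
    then show False
      using s that unfolding B_def by blast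
  qed
  then have "m = m'" if "m \<in> M" "m' \<in> M" "s powi m = s powi m'" for m m'
    using that by (metis linorder_neqE)
  with s0 show ?thesis
    by (rule that)
qed

lemma dim_quot_eq_card:
  fixes s1 :: "'k::field \<Rightarrow> 'v::ab_group_add \<Rightarrow> 'v" and s2 :: "'k \<Rightarrow> 'w::ab_group_add \<Rightarrow> 'w"
  assumes lin: "Vector_Spaces.linear s1 s2 f"
    and V: "module.subspace s1 V" and W: "W = {v \<in> V. f v = 0}"
    and B: "\<not> module.dependent s2 B" "f ` V = module.span s2 B"
  shows "dim_quot s1 V W = card B"
proof -
  interpret f: Vector_Spaces.linear s1 s2 f by fact
  have im: "f.vs2.span (f ` A) = f ` f.vs1.span A" for A
    by (rule f.span_image)
  have WS: "f ` f.vs1.span (W \<union> A) = f.vs2.span (f ` A)" for A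
  proof -
    have "f ` (W \<union> A) \<subseteq> insert 0 (f ` A)"
      using W by auto
    then have "f.vs2.span (f ` (W \<union> A)) \<subseteq> f.vs2.span (f ` A)"
      by (metis f.vs2.span_insert_0 f.vs2.span_mono)
    moreover have "f.vs2.span (f ` A) \<subseteq> f.vs2.span (f ` (W \<union> A))"
      by (rule f.vs2.span_mono) auto
    ultimately show ?thesis
      by (simp add: im)
  qed
  have lift: "v \<in> f.vs1.span (W \<union> A)" if "v \<in> V" "A \<subseteq> V" "f v \<in> f.vs2.span (f ` A)" for v A
  proof -
    obtain t where t: "t \<in> f.vs1.span A" "f v = f t"
      using \<open>f v \<in> f.vs2.span (f ` A)\<close> by (auto simp: im)
    have "t \<in> V"
      using f.vs1.span_minimal[OF \<open>A \<subseteq> V\<close> V] t by auto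
    then have "v - t \<in> W"
      using W t \<open>v \<in> V\<close> f.vs1.subspace_diff[OF V] by (auto simp: f.diff)
    then have "v - t \<in> f.vs1.span (W \<union> A)"
      by (intro f.vs1.span_base) auto
    moreover have "t \<in> f.vs1.span (W \<union> A)"
      using t f.vs1.span_mono[of A "W \<union> A"] by auto
    ultimately show ?thesis
      using f.vs1.span_add by fastforce
  qed
  have card_eq: "card S = card B" if S: "quot_basis s1 V W S" for S
  proof -
    have SV: "S \<subseteq> V" and Vs: "V \<subseteq> f.vs1.span (W \<union> S)"
      and ns: "\<And>s. s \<in> S \<Longrightarrow> s \<notin> f.vs1.span (W \<union> (S - {s}))"
      using S by (auto simp: quot_basis_def)
    have nf: "f s \<notin> f.vs2.span (f ` (S - {s}))" if "s \<in> S" for s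
      using lift[of s "S - {s}"] ns[OF that] SV that by blast
    have inj: "inj_on f S"
    proof (rule inj_onI, rule ccontr)
      fix x y assume "x \<in> S" "y \<in> S" "f x = f y" "x \<noteq> y"
      then have "f x \<in> f ` (S - {x})"
        by (intro image_eqI[of _ _ y]) auto
      then show False
        using nf[OF \<open>x \<in> S\<close>] f.vs2.span_base[of "f x" "f ` (S - {x})"] by simp
    qed
    have "f.vs2.independent (f ` S)"
    proof
      assume "f.vs2.dependent (f ` S)"
      then obtain s where "s \<in> S" "f s \<in> f.vs2.span (f ` S - {f s})"
        by (auto simp: f.vs2.dependent_def)
      moreover have "f ` S - {f s} \<subseteq> f ` (S - {s})"
        by auto
      ultimately show False
        using nf[of s] f.vs2.span_mono by blast
    qed
    moreover have "f.vs2.span (f ` S) = f.vs2.span B"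
    proof
      show "f.vs2.span (f ` S) \<subseteq> f.vs2.span B"
        using SV B(2) by (intro f.vs2.span_minimal) auto
      have "f ` V \<subseteq> f ` f.vs1.span (W \<union> S)"
        using Vs by auto
      then show "f.vs2.span B \<subseteq> f.vs2.span (f ` S)"
        by (simp only: WS B(2))
    qed
    ultimately have "card (f ` S) = card B"
      by (metis B(1) f.vs2.dim_span_eq_card_independent)
    then show ?thesis
      by (simp add: card_image[OF inj])
  qed
  have "\<exists>S. quot_basis s1 V W S"
  proof -
    have "\<forall>b\<in>B. \<exists>v\<in>V. f v = b"
      using B(2) f.vs2.span_base[of _ B] by (metis imageE)
    then obtain g where g: "\<And>b. b \<in> B \<Longrightarrow> g b \<in> V \<and> f (g b) = b"
      by metis
    have fg: "f ` g ` A = A" if "A \<subseteq> B" for A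
    proof -
      have "f ` g ` A = (\<lambda>b. b) ` A"
        unfolding image_image using g that by (intro image_cong) auto
      then show ?thesis by simp
    qed
    have "quot_basis s1 V W (g ` B)"
      unfolding quot_basis_def
    proof (intro conjI ballI)
      show "g ` B \<subseteq> V" using g by auto
      then show "V \<subseteq> f.vs1.span (W \<union> g ` B)"
        using lift[of _ "g ` B"] fg[of B] imageI[of _ V f] B(2) by (metis order_refl subsetI)
      fix s assume "s \<in> g ` B"
      then obtain b where b: "b \<in> B" "s = g b" by auto
      show "s \<notin> f.vs1.span (W \<union> (g ` B - {s}))"
      proof
        assume "s \<in> f.vs1.span (W \<union> (g ` B - {s}))"
        then have "f s \<in> f.vs2.span (f ` (g ` B - {s}))"
          using WS by blast
        moreover have "f ` (g ` B - {s}) \<subseteq> B - {b}"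
          using g b by auto
        ultimately have "b \<in> f.vs2.span (B - {b})"
          using g[OF b(1)] b(2) f.vs2.span_mono[of "f ` (g ` B - {s})" "B - {b}"] by auto
        then show False
          using B(1) b(1) unfolding f.vs2.dependent_def by blast
      qed
    qed
    then show ?thesis by blast
  qed
  then have "quot_basis s1 V W (SOME S. quot_basis s1 V W S)"
    by (rule someI_ex)
  then show ?thesis
    unfolding dim_quot_def by (rule card_eq)
qed

text \<open>Meant for cohomology in positive degree, once cocycles are known to be coboundaries. A
  nonempty candidate basis would contain a vector of W, which is in the span to be avoided.\<close>

lemma ch_eq_0:
  assumes "vector_space sc" "V \<subseteq> W"
  shows "ch sc act V W = 0"
proof -
  interpret vector_space sc by fact
  have "dim_quot sc (weight_space sc act V W l) W = 0" for l
  proof -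
    let ?U = "weight_space sc act V W l"
    have sub: "?U \<subseteq> W"
      using assms(2) by (auto simp: weight_space_def)
    have "S = {}" if "quot_basis sc ?U W S" for S
    proof (rule equals0I)
      fix s assume s: "s \<in> S"
      with that have "s \<in> W" and "s \<notin> span (W \<union> (S - {s}))"
        using sub by (auto simp: quot_basis_def)
      then show False
        by (auto intro: span_base)
    qed
    moreover have "quot_basis sc ?U W {}"
      using sub span_superset by (auto simp: quot_basis_def)
    ultimately have "(SOME S. quot_basis sc ?U W S) = {}"
      using someI[of "quot_basis sc ?U W" "{}"] by blast
    then show ?thesis
      by (simp only: dim_quot_def card.empty)
  qed
  then show ?thesis
    unfolding ch_def zero_poly_mapping_def by simp
qed

text \<open>Passes from indexed families, in which the coefficient arguments are carried out, to
  sets of vectors, in which \<open>span\<close> and \<open>independent\<close> are stated.\<close>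

lemma (in vector_space) independent_family:
  assumes "finite I" "\<And>a. (\<Sum>i\<in>I. scale (a i) (e i)) = 0 \<Longrightarrow> \<forall>i\<in>I. a i = 0" "J \<subseteq> I"
  shows "inj_on e J" "independent (e ` J)" "span (e ` J) = range (\<lambda>a. \<Sum>i\<in>J. scale (a i) (e i))"
proof -
  have fJ: "finite J"
    using assms finite_subset by blast
  have ind: "\<forall>i\<in>J. a i = 0" if "(\<Sum>i\<in>J. scale (a i) (e i)) = 0" for a
  proof -
    have "(\<Sum>i\<in>I. scale (if i \<in> J then a i else 0) (e i)) = (\<Sum>i\<in>J. scale (a i) (e i))"
      using assms(1,3) by (intro sum.mono_neutral_cong_right) auto
    with that assms(2)[of "\<lambda>i. if i \<in> J then a i else 0"]
    have "\<forall>i\<in>I. (if i \<in> J then a i else 0) = 0"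
      by simp
    with assms(3) show ?thesis
      by (metis subsetD)
  qed
  show inj: "inj_on e J"
  proof (rule inj_onI, rule ccontr)
    fix i j assume ij: "i \<in> J" "j \<in> J" "e i = e j" "i \<noteq> j"
    \<comment> \<open>A repeated vector would give the nontrivial relation e_i - e_j = 0.\<close>
    let ?a = "\<lambda>m. if m = i then (1 :: 'a) else if m = j then - 1 else 0"
    have "(\<Sum>m\<in>J. scale (?a m) (e m)) = (\<Sum>m\<in>{i, j}. scale (?a m) (e m))"
      using fJ ij by (intro sum.mono_neutral_right) auto
    also have "\<dots> = 0"
      using ij by simp
    finally have "\<forall>m\<in>J. ?a m = 0"
      using ind[of ?a] by blast
    with ij show False by auto
  qed
  show "independent (e ` J)"
  proof (rule independent_if_scalars_zero)
    fix f x assume *: "(\<Sum>x\<in>e ` J. scale (f x) x) = 0" "x \<in> e ` J"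
    then have "(\<Sum>i\<in>J. scale (f (e i)) (e i)) = 0"
      by (simp add: sum.reindex[OF inj])
    with ind[of "\<lambda>i. f (e i)"] * show "f x = 0"
      by auto
  qed (use fJ in auto)
  show "span (e ` J) = range (\<lambda>a. \<Sum>i\<in>J. scale (a i) (e i))"
  proof
    show "range (\<lambda>a. \<Sum>i\<in>J. scale (a i) (e i)) \<subseteq> span (e ` J)"
      by (clarify, intro span_sum span_scale span_base) auto
    show "span (e ` J) \<subseteq> range (\<lambda>a. \<Sum>i\<in>J. scale (a i) (e i))"
    proof
      fix v assume "v \<in> span (e ` J)"
      then obtain u where "v = (\<Sum>x\<in>e ` J. scale (u x) x)"
        using fJ by (auto simp: span_finite)
      then have "v = (\<Sum>i\<in>J. scale (u (e i)) (e i))"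
        by (simp add: sum.reindex[OF inj])
      then show "v \<in> range (\<lambda>a. \<Sum>i\<in>J. scale (a i) (e i))"
        by auto
    qed
  qed
qed

text \<open>The map f identifies V/W with its image, which has a basis of torus eigenvectors
  \<open>e i\<close> of weight \<open>w i\<close>. The action is described by its effect on
  coordinates, so that the target of f carries no action of its own. Both characters of the theorem
  are computed in this way.\<close>

lemma ch_eq_weight_multiplicities:
  fixes s1 :: "'k::field \<Rightarrow> 'v::ab_group_add \<Rightarrow> 'v" and s2 :: "'k \<Rightarrow> 'w::ab_group_add \<Rightarrow> 'w"
    and e :: "'i \<Rightarrow> 'w" and w :: "'i \<Rightarrow> int"
  assumes inf: "infinite (UNIV :: 'k set)" and lin: "Vector_Spaces.linear s1 s2 f"
    and V: "module.subspace s1 V" and W: "W = {v \<in> V. f v = 0}"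
    and I: "finite I" and ind: "\<And>a. (\<Sum>i\<in>I. s2 (a i) (e i)) = 0 \<Longrightarrow> \<forall>i\<in>I. a i = 0"
    and im: "f ` V = range (\<lambda>a. \<Sum>i\<in>I. s2 (a i) (e i))"
    and stable: "\<And>s v. s \<noteq> 0 \<Longrightarrow> v \<in> V \<Longrightarrow> act (torus s) v \<in> V"
    and weights: "\<And>s v a. s \<noteq> 0 \<Longrightarrow> v \<in> V \<Longrightarrow> f v = (\<Sum>i\<in>I. s2 (a i) (e i)) \<Longrightarrow>
      f (act (torus s) v) = (\<Sum>i\<in>I. s2 (s powi w i * a i) (e i))"
  shows "ch s1 act V W = Abs_poly_mapping (\<lambda>l. int (card {i \<in> I. w i = l}))"
proof -
  interpret f: Vector_Spaces.linear s1 s2 f by fact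
  note ind' = f.vs2.independent_family[OF I ind]
  have "dim_quot s1 (weight_space s1 act V W l) W = card {i \<in> I. w i = l}" for l
  proof -
    let ?U = "weight_space s1 act V W l" and ?J = "{i \<in> I. w i = l}"
    have U_iff: "v \<in> ?U \<longleftrightarrow> (\<forall>i\<in>I. w i \<noteq> l \<longrightarrow> a i = 0)"
      if v: "v \<in> V" and a: "f v = (\<Sum>i\<in>I. s2 (a i) (e i))" for v a
    proof -
      have in_W: "act (torus s) v - s1 (s powi l) v \<in> W \<longleftrightarrow>
          (\<forall>i\<in>I. (s powi w i - s powi l) * a i = 0)" if s: "s \<noteq> 0" for s
      proof -
        have "f (act (torus s) v - s1 (s powi l) v)
            = (\<Sum>i\<in>I. s2 (s powi w i * a i) (e i)) - s2 (s powi l) (\<Sum>i\<in>I. s2 (a i) (e i))"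
          using weights[OF s v a] a by (simp add: f.diff f.scale)
        also have "\<dots> = (\<Sum>i\<in>I. s2 ((s powi w i - s powi l) * a i) (e i))"
          by (simp add: f.vs2.scale_sum_right sum_subtractf f.vs2.scale_left_diff_distrib
              left_diff_distrib)
        finally have fe: "f (act (torus s) v - s1 (s powi l) v) =
            (\<Sum>i\<in>I. s2 ((s powi w i - s powi l) * a i) (e i))" .
        have "act (torus s) v - s1 (s powi l) v \<in> V"
          using stable[OF s v] v V by (intro f.vs1.subspace_diff f.vs1.subspace_scale) auto
        then have "act (torus s) v - s1 (s powi l) v \<in> W \<longleftrightarrow>
            (\<Sum>i\<in>I. s2 ((s powi w i - s powi l) * a i) (e i)) = 0"
          by (simp only: W mem_Collect_eq fe) simp
        also have "\<dots> \<longleftrightarrow> (\<forall>i\<in>I. (s powi w i - s powi l) * a i = 0)"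
        proof
          assume "(\<Sum>i\<in>I. s2 ((s powi w i - s powi l) * a i) (e i)) = 0"
          from ind[OF this] show "\<forall>i\<in>I. (s powi w i - s powi l) * a i = 0" .
        next
          assume "\<forall>i\<in>I. (s powi w i - s powi l) * a i = 0"
          then show "(\<Sum>i\<in>I. s2 ((s powi w i - s powi l) * a i) (e i)) = 0"
            by (intro sum.neutral ballI) simp
        qed
        finally show ?thesis .
      qed
      show ?thesis
      proof
        assume vU: "v \<in> ?U"
        \<comment> \<open>One torus element that separates l from all other weights is enough to
          kill the components of weight different from l.\<close>
        obtain s :: 'k where s: "s \<noteq> 0"
          "\<And>m m'. m \<in> insert l (w ` I) \<Longrightarrow> m' \<in> insert l (w ` I) \<Longrightarrow> s powi m = s powi m' \<Longrightarrow> m = m'"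
          using I by (rule_tac exists_separating_scalar[OF inf, of "insert l (w ` I)"]) (simp, blast)
        have "act (torus s) v - s1 (s powi l) v \<in> W"
          using vU s(1) by (auto simp: weight_space_def)
        then have *: "\<forall>i\<in>I. (s powi w i - s powi l) * a i = 0"
          using in_W[OF s(1)] by simp
        show "\<forall>i\<in>I. w i \<noteq> l \<longrightarrow> a i = 0"
        proof (intro ballI impI)
          fix i assume i: "i \<in> I" "w i \<noteq> l"
          then have "s powi w i \<noteq> s powi l"
            using s(2)[of "w i" l] by auto
          then show "a i = 0"
            using * i by auto
        qed
      next
        assume "\<forall>i\<in>I. w i \<noteq> l \<longrightarrow> a i = 0"
        then show "v \<in> ?U"
          using v in_W unfolding weight_space_def by auto
      qed
    qed
    have rep: "\<exists>a. f v = (\<Sum>i\<in>I. s2 (a i) (e i))" if "v \<in> V" for v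
      using im that by auto
    have UV: "?U \<subseteq> V"
      by (auto simp: weight_space_def)
    have sub: "f.vs1.subspace ?U"
    proof (rule f.vs1.subspaceI)
      show "0 \<in> ?U"
        using U_iff[of 0 "\<lambda>_. 0"] f.vs1.subspace_0[OF V] by (simp add: f.zero)
    next
      fix x y assume xy: "x \<in> ?U" "y \<in> ?U"
      then obtain a b where a: "f x = (\<Sum>i\<in>I. s2 (a i) (e i))" and b: "f y = (\<Sum>i\<in>I. s2 (b i) (e i))"
        using rep UV by blast
      have "f (x + y) = (\<Sum>i\<in>I. s2 (a i + b i) (e i))"
        by (simp add: f.add a b f.vs2.scale_left_distrib sum.distrib)
      moreover have "x + y \<in> V"
        using xy UV f.vs1.subspace_add[OF V] by auto
      ultimately show "x + y \<in> ?U"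
        using U_iff[OF _ a] U_iff[OF _ b] U_iff[of "x + y" "\<lambda>i. a i + b i"] xy UV
        by (metis add.right_neutral subsetD)
    next
      fix c x assume x: "x \<in> ?U"
      then obtain a where a: "f x = (\<Sum>i\<in>I. s2 (a i) (e i))"
        using rep UV by blast
      have "f (s1 c x) = (\<Sum>i\<in>I. s2 (c * a i) (e i))"
        by (simp add: f.scale a f.vs2.scale_sum_right)
      moreover have "s1 c x \<in> V"
        using x UV f.vs1.subspace_scale[OF V] by auto
      ultimately show "s1 c x \<in> ?U"
        using U_iff[OF _ a] U_iff[of "s1 c x" "\<lambda>i. c * a i"] x UV by auto
    qed
    have "W = {v \<in> ?U. f v = 0}"
      using U_iff[of _ "\<lambda>_. 0"] UV by (auto simp: W)
    moreover have "f ` ?U = f.vs2.span (e ` ?J)"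
    proof
      show "f ` ?U \<subseteq> f.vs2.span (e ` ?J)"
      proof clarify
        fix v assume v: "v \<in> ?U"
        then obtain a where a: "f v = (\<Sum>i\<in>I. s2 (a i) (e i))"
          using rep UV by blast
        have "s2 (a i) (e i) \<in> f.vs2.span (e ` ?J)" if "i \<in> I" for i
        proof (cases "w i = l")
          case True
          with that show ?thesis
            by (intro f.vs2.span_scale f.vs2.span_base) auto
        next
          case False
          then have "a i = 0"
            using U_iff[OF _ a] v UV that by blast
          then show ?thesis
            by (simp add: f.vs2.span_zero)
        qed
        then show "f v \<in> f.vs2.span (e ` ?J)"
          unfolding a by (rule f.vs2.span_sum)
      qed
      show "f.vs2.span (e ` ?J) \<subseteq> f ` ?U"
      proof
        fix y assume "y \<in> f.vs2.span (e ` ?J)"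
        then obtain a where "y = (\<Sum>i\<in>?J. s2 (a i) (e i))"
          using ind'(3)[where J = ?J] by auto
        also have "\<dots> = (\<Sum>i\<in>I. s2 (if w i = l then a i else 0) (e i))"
          using I by (intro sum.mono_neutral_cong_left) auto
        finally have y: "y = (\<Sum>i\<in>I. s2 (if w i = l then a i else 0) (e i))" .
        then have "y \<in> f ` V"
          by (simp only: im) (rule rangeI)
        then obtain v where v: "v \<in> V" "f v = y"
          by auto
        then have "v \<in> ?U"
          using U_iff[of v "\<lambda>i. if w i = l then a i else 0"] y by auto
        with v show "y \<in> f ` ?U" by auto
      qed
    qed
    moreover have "f.vs2.independent (e ` ?J)"
      by (rule ind'(2)) auto
    ultimately have "dim_quot s1 ?U W = card (e ` ?J)"
      by (intro dim_quot_eq_card[OF lin sub])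
    also have "\<dots> = card ?J"
      by (rule card_image) (rule ind'(1), auto)
    finally show ?thesis .
  qed
  then show ?thesis
    by (simp add: ch_def)
qed

no_notation fps_nth (infixl "$" 75)

section \<open>Polynomial functions\<close>

interpretation fun_space: vector_space "fun_scale ((*) :: 'k::field \<Rightarrow> 'k \<Rightarrow> 'k)"
  by (rule vector_space_fun_scale) (rule vector_space_over_itself.vector_space_axioms)

lemma linear_fun_scaleI:
  fixes f :: "('p \<Rightarrow> 'k::field) \<Rightarrow> 'q \<Rightarrow> 'k"
  assumes "\<And>F G. f (F + G) = f F + f G" "\<And>c F. f (fun_scale (*) c F) = fun_scale (*) c (f F)"
  shows "Vector_Spaces.linear (fun_scale (*)) (fun_scale (*)) f"
  unfolding Vector_Spaces.linear_def module_hom_iff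
  by (intro conjI allI assms fun_space.vector_space_axioms fun_space.module_axioms)

text \<open>Extension by zero is the encoding used in \<open>homogeneous_maps\<close> and
  \<open>regular_maps\<close> for functions on a closed subset.\<close>

definition on_set :: "'p set \<Rightarrow> ('p \<Rightarrow> 'v::zero) \<Rightarrow> 'p \<Rightarrow> 'v" where
  "on_set X f = (\<lambda>x. if x \<in> X then f x else 0)"

lemma on_set_in [simp]: "x \<in> X \<Longrightarrow> on_set X f x = f x"
  and on_set_notin [simp]: "x \<notin> X \<Longrightarrow> on_set X f x = 0"
  by (auto simp: on_set_def)

lemma linear_on_set:
  "Vector_Spaces.linear (fun_scale ((*) :: 'k::field \<Rightarrow> _)) (fun_scale (*)) (on_set X)"
  by (rule linear_fun_scaleI) (auto simp: on_set_def fun_scale_def fun_eq_iff)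

inductive_set polyfuns :: "('p \<Rightarrow> 'k::comm_ring_1) set \<Rightarrow> ('p \<Rightarrow> 'k) set"
  for cs :: "('p \<Rightarrow> 'k) set" where
  const: "(\<lambda>_. c) \<in> polyfuns cs"
| coord: "f \<in> cs \<Longrightarrow> f \<in> polyfuns cs"
| add: "f \<in> polyfuns cs \<Longrightarrow> g \<in> polyfuns cs \<Longrightarrow> (\<lambda>x. f x + g x) \<in> polyfuns cs"
| mult: "f \<in> polyfuns cs \<Longrightarrow> g \<in> polyfuns cs \<Longrightarrow> (\<lambda>x. f x * g x) \<in> polyfuns cs"

text \<open>Values outside X are left free, unlike in \<open>regular_maps\<close>. This gives
  closure under the algebra operations without any bookkeeping for the extension by zero.\<close>

definition polyfuns_on :: "('p \<Rightarrow> 'k::comm_ring_1) set \<Rightarrow> 'p set \<Rightarrow> ('p \<Rightarrow> 'k) set" where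
  "polyfuns_on cs X = {f. \<exists>p\<in>polyfuns cs. \<forall>x\<in>X. f x = p x}"

lemma polyfuns_onI: "p \<in> polyfuns cs \<Longrightarrow> (\<And>x. x \<in> X \<Longrightarrow> f x = p x) \<Longrightarrow> f \<in> polyfuns_on cs X"
  by (auto simp: polyfuns_on_def)

lemma polyfuns_on_cong: "f \<in> polyfuns_on cs X \<Longrightarrow> (\<And>x. x \<in> X \<Longrightarrow> g x = f x) \<Longrightarrow> g \<in> polyfuns_on cs X"
  by (auto simp: polyfuns_on_def)

lemma polyfuns_on_const: "(\<lambda>_. c) \<in> polyfuns_on cs X"
  by (rule polyfuns_onI[OF polyfuns.const]) simp

lemma polyfuns_on_coord: "f \<in> cs \<Longrightarrow> f \<in> polyfuns_on cs X"
  by (rule polyfuns_onI[OF polyfuns.coord]) simp_all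

lemma polyfuns_on_add:
  assumes "f \<in> polyfuns_on cs X" "g \<in> polyfuns_on cs X"
  shows "(\<lambda>x. f x + g x) \<in> polyfuns_on cs X"
proof -
  from assms obtain p q where "p \<in> polyfuns cs" "\<forall>x\<in>X. f x = p x" "q \<in> polyfuns cs" "\<forall>x\<in>X. g x = q x"
    by (auto simp: polyfuns_on_def)
  then show ?thesis
    by (intro polyfuns_onI[OF polyfuns.add[of p cs q]]) auto
qed

lemma polyfuns_on_mult:
  assumes "f \<in> polyfuns_on cs X" "g \<in> polyfuns_on cs X"
  shows "(\<lambda>x. f x * g x) \<in> polyfuns_on cs X"
proof -
  from assms obtain p q where "p \<in> polyfuns cs" "\<forall>x\<in>X. f x = p x" "q \<in> polyfuns cs" "\<forall>x\<in>X. g x = q x"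
    by (auto simp: polyfuns_on_def)
  then show ?thesis
    by (intro polyfuns_onI[OF polyfuns.mult[of p cs q]]) auto
qed

lemma polyfuns_on_minus: "f \<in> polyfuns_on cs X \<Longrightarrow> (\<lambda>x. - f x) \<in> polyfuns_on cs X"
  using polyfuns_on_mult[OF polyfuns_on_const[of "- 1"], of f cs X] by simp

lemma polyfuns_on_power: "f \<in> polyfuns_on cs X \<Longrightarrow> (\<lambda>x. f x ^ n) \<in> polyfuns_on cs X"
  by (induction n) (auto intro: polyfuns_on_const polyfuns_on_mult)

lemma polyfuns_on_sum:
  "(\<And>i. i \<in> I \<Longrightarrow> f i \<in> polyfuns_on cs X) \<Longrightarrow> (\<lambda>x. \<Sum>i\<in>I. f i x) \<in> polyfuns_on cs X"
  by (induction I rule: infinite_finite_induct) (auto intro: polyfuns_on_const polyfuns_on_add)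

lemma polyfuns_on_comp:
  assumes "f \<in> polyfuns_on cs X" "\<phi> ` Y \<subseteq> X"
    and "\<And>c. c \<in> cs \<Longrightarrow> (\<lambda>x. c (\<phi> x)) \<in> polyfuns_on cs' Y"
  shows "(\<lambda>x. f (\<phi> x)) \<in> polyfuns_on cs' Y"
proof -
  obtain p where p: "p \<in> polyfuns cs" "\<forall>x\<in>X. f x = p x"
    using assms(1) by (auto simp: polyfuns_on_def)
  from p(1) have "(\<lambda>x. p (\<phi> x)) \<in> polyfuns_on cs' Y"
    by induction (auto intro: polyfuns_on_const polyfuns_on_add polyfuns_on_mult assms(3))
  then show ?thesis
    by (rule polyfuns_on_cong) (use p(2) assms(2) in auto)
qed

text \<open>Here \<phi> is a rational map whose denominators are powers of u, so each polynomial in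
  its coordinates has a pole of bounded order along u = 0. Asking for all large exponents lets two
  summands share one exponent; for a product the two bounds add.\<close>

lemma polyfuns_on_comp_pole:
  assumes "p \<in> polyfuns cs" "u \<in> polyfuns_on cs' Y"
    and "\<And>c. c \<in> cs \<Longrightarrow> \<exists>N. \<forall>M\<ge>N. (\<lambda>x. u x ^ M * c (\<phi> x)) \<in> polyfuns_on cs' Y"
  shows "\<exists>N. \<forall>M\<ge>N. (\<lambda>x. u x ^ M * p (\<phi> x)) \<in> polyfuns_on cs' Y"
  using assms(1)
proof induction
  case (const c)
  then show ?case
    by (intro exI[of _ 0] allI impI polyfuns_on_mult polyfuns_on_power assms(2) polyfuns_on_const)
next
  case (coord f)
  then show ?case by (rule assms(3))
next
  case (add f g)
  then obtain N1 N2 where "\<forall>M\<ge>N1. (\<lambda>x. u x ^ M * f (\<phi> x)) \<in> polyfuns_on cs' Y"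
    "\<forall>M\<ge>N2. (\<lambda>x. u x ^ M * g (\<phi> x)) \<in> polyfuns_on cs' Y"
    by blast
  then have "(\<lambda>x. u x ^ M * f (\<phi> x) + u x ^ M * g (\<phi> x)) \<in> polyfuns_on cs' Y"
    if "M \<ge> max N1 N2" for M
    using that by (intro polyfuns_on_add) auto
  then show ?case
    by (intro exI[of _ "max N1 N2"]) (simp add: distrib_left)
next
  case (mult f g)
  then obtain N1 N2 where N: "\<forall>M\<ge>N1. (\<lambda>x. u x ^ M * f (\<phi> x)) \<in> polyfuns_on cs' Y"
    "\<forall>M\<ge>N2. (\<lambda>x. u x ^ M * g (\<phi> x)) \<in> polyfuns_on cs' Y"
    by blast
  have "(\<lambda>x. u x ^ M * (f (\<phi> x) * g (\<phi> x))) \<in> polyfuns_on cs' Y" if "M \<ge> N1 + N2" for M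
  proof -
    define K where "K = M - N1"
    with that have K: "M = N1 + K" "K \<ge> N2"
      by auto
    then have "(\<lambda>x. u x ^ M * (f (\<phi> x) * g (\<phi> x))) = (\<lambda>x. (u x ^ N1 * f (\<phi> x)) * (u x ^ K * g (\<phi> x)))"
      by (simp add: power_add mult_ac)
    then show ?thesis
      using N K(2) by (simp add: polyfuns_on_mult)
  qed
  then show ?case by blast
qed

text \<open>Restriction to a polynomially parametrized curve. It is applied to curves in
  \<open>G\<close> that represent the affine charts of \<open>G/B\<close>.\<close>

lemma polyfuns_comp_poly:
  assumes "p \<in> polyfuns cs" "\<And>f. f \<in> cs \<Longrightarrow> \<exists>P. \<forall>z. f (\<phi> z) = poly P z"
  shows "\<exists>P. \<forall>z. p (\<phi> z) = poly P z"
  using assms(1)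
proof induction
  case (const c)
  show ?case by (intro exI[of _ "[:c:]"]) simp
next
  case (coord f)
  then show ?case by (rule assms(2))
next
  case (add f g)
  then show ?case by (metis poly_add)
next
  case (mult f g)
  then show ?case by (metis poly_mult)
qed

section \<open>Monomials as spanning sets of polynomial functions\<close>

lemma monomial_funsE:
  assumes "m \<in> monomial_funs cs d"
  obtains zs where "m = (\<lambda>x. \<Prod>c\<leftarrow>zs. c x)" "length zs = d" "set zs \<subseteq> cs"
  using assms unfolding monomial_funs_def by blast

lemma monomial_funs_mult:
  assumes "f \<in> monomial_funs cs d" "g \<in> monomial_funs cs e"
  shows "(\<lambda>x. f x * g x) \<in> monomial_funs cs (d + e)"
proof -
  obtain xs ys where "length xs = d" "set xs \<subseteq> cs" "f = (\<lambda>x. \<Prod>c\<leftarrow>xs. c x)"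
    "length ys = e" "set ys \<subseteq> cs" "g = (\<lambda>x. \<Prod>c\<leftarrow>ys. c x)"
    using assms unfolding monomial_funs_def by blast
  then show ?thesis
    unfolding monomial_funs_def by (intro CollectI exI[of _ "xs @ ys"]) auto
qed

lemma monomial_funs_polyfuns: "m \<in> monomial_funs cs d \<Longrightarrow> m \<in> polyfuns cs"
proof -
  have "(\<lambda>x. \<Prod>c\<leftarrow>zs. c x) \<in> polyfuns cs" if "set zs \<subseteq> cs" for zs
    using that by (induction zs) (auto intro: polyfuns.intros)
  then show "m \<in> monomial_funs cs d \<Longrightarrow> m \<in> polyfuns cs"
    unfolding monomial_funs_def by auto
qed

lemma subspace_polyfuns: "fun_space.subspace (polyfuns cs)"
proof (rule fun_space.subspaceI)
  show "0 \<in> polyfuns cs"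
    using polyfuns.const[of 0] by (simp add: zero_fun_def)
  show "x + y \<in> polyfuns cs" if "x \<in> polyfuns cs" "y \<in> polyfuns cs" for x y
    using polyfuns.add[OF that] by (simp add: plus_fun_def)
  show "fun_scale (*) c x \<in> polyfuns cs" if "x \<in> polyfuns cs" for c x
    using polyfuns.mult[OF polyfuns.const[of c] that] by (simp add: fun_scale_def)
qed

text \<open>The point is that the span of the monomials is closed under products. This is proved one
  factor at a time: multiplication by a fixed function is linear, so it suffices to take first one
  and then the other factor to be a monomial.\<close>

lemma polyfuns_eq_span: "polyfuns cs = fun_space.span (\<Union>d. monomial_funs cs d)"
proof
  show "fun_space.span (\<Union>d. monomial_funs cs d) \<subseteq> polyfuns cs"
    by (rule fun_space.span_minimal) (auto simp: subspace_polyfuns monomial_funs_polyfuns)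
  let ?S = "fun_space.span (\<Union>d. monomial_funs cs d)"
  have base: "m \<in> ?S" if "m \<in> monomial_funs cs d" for m d
    using that by (intro fun_space.span_base) auto
  have mult_sub: "fun_space.subspace {f. (\<lambda>x. f x * g x) \<in> ?S}" for g
  proof (rule fun_space.subspaceI)
    show "0 \<in> {f. (\<lambda>x. f x * g x) \<in> ?S}"
      using fun_space.span_zero by (simp add: zero_fun_def)
    show "f + h \<in> {f. (\<lambda>x. f x * g x) \<in> ?S}"
      if "f \<in> {f. (\<lambda>x. f x * g x) \<in> ?S}" "h \<in> {f. (\<lambda>x. f x * g x) \<in> ?S}" for f h
      using fun_space.span_add[of "\<lambda>x. f x * g x" _ "\<lambda>x. h x * g x"] that
      by (simp add: plus_fun_def distrib_right)
    show "fun_scale (*) c f \<in> {f. (\<lambda>x. f x * g x) \<in> ?S}"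
      if "f \<in> {f. (\<lambda>x. f x * g x) \<in> ?S}" for c f
      using fun_space.span_scale[of "\<lambda>x. f x * g x" _ c] that
      by (simp add: fun_scale_def mult.assoc)
  qed
  have 1: "(\<lambda>x. f x * m x) \<in> ?S" if "f \<in> ?S" "m \<in> monomial_funs cs d" for f m d
  proof -
    have "?S \<subseteq> {f. (\<lambda>x. f x * m x) \<in> ?S}"
      using that(2) by (intro fun_space.span_minimal mult_sub) (auto intro: base monomial_funs_mult)
    with that(1) show ?thesis by auto
  qed
  have 2: "(\<lambda>x. f x * g x) \<in> ?S" if "f \<in> ?S" "g \<in> ?S" for f g
  proof -
    have "?S \<subseteq> {h. (\<lambda>x. h x * f x) \<in> ?S}"
      using 1[OF that(1)] by (intro fun_space.span_minimal mult_sub) (auto simp: mult.commute)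
    with that(2) show ?thesis by (auto simp: mult.commute)
  qed
  show "polyfuns cs \<subseteq> ?S"
  proof
    fix p assume "p \<in> polyfuns cs"
    then show "p \<in> ?S"
    proof induction
      case (const c)
      have "(\<lambda>_. 1) \<in> monomial_funs cs 0"
        by (auto simp: monomial_funs_def)
      from fun_space.span_scale[OF base[OF this], of c] show ?case
        unfolding fun_scale_def by simp
    next
      case (coord f)
      then have "f \<in> monomial_funs cs 1"
        unfolding monomial_funs_def by (intro CollectI exI[of _ "[f]"]) auto
      then show ?case by (rule base)
    next
      case (add f g)
      with fun_space.span_add[of f _ g] show ?case
        by (simp add: plus_fun_def)
    next
      case (mult f g)
      then show ?case by (intro 2)
    qed
  qed
qed

text \<open>For values in k the vector v of the definition is a scalar and is absorbed by the
  span.\<close>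

lemma homogeneous_maps_eq:
  "homogeneous_maps (*) cs X d = on_set X ` fun_space.span (monomial_funs cs d)"
proof -
  interpret r: Vector_Spaces.linear "fun_scale (*)" "fun_scale (*)" "on_set X :: _ \<Rightarrow> 'a \<Rightarrow> 'b"
    by (rule linear_on_set)
  let ?G = "{\<lambda>x. if x \<in> X then m x * v else 0 | m v. m \<in> monomial_funs cs d}"
  have "fun_space.span ?G = fun_space.span (on_set X ` monomial_funs cs d)"
  proof
    have "(\<lambda>x. if x \<in> X then m x * v else 0) \<in> fun_space.span (on_set X ` monomial_funs cs d)"
      if "m \<in> monomial_funs cs d" for m v
    proof -
      have "(\<lambda>x. if x \<in> X then m x * v else 0) = fun_scale (*) v (on_set X m)"
        by (auto simp: on_set_def fun_scale_def fun_eq_iff)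
      moreover have "\<dots> \<in> fun_space.span (on_set X ` monomial_funs cs d)"
        using that by (intro fun_space.span_scale fun_space.span_base) auto
      ultimately show ?thesis by simp
    qed
    then show "fun_space.span ?G \<subseteq> fun_space.span (on_set X ` monomial_funs cs d)"
      by (intro fun_space.span_minimal) auto
    have "on_set X m \<in> ?G" if "m \<in> monomial_funs cs d" for m
      using that by (intro CollectI exI[of _ m] exI[of _ 1]) (auto simp: on_set_def)
    then show "fun_space.span (on_set X ` monomial_funs cs d) \<subseteq> fun_space.span ?G"
      by (intro fun_space.span_mono) auto
  qed
  then show ?thesis
    by (simp add: homogeneous_maps_def r.span_image)
qed

lemma regular_maps_eq: "regular_maps (*) cs X = on_set X ` polyfuns cs"
proof -
  interpret r: Vector_Spaces.linear "fun_scale (*)" "fun_scale (*)" "on_set X :: _ \<Rightarrow> 'a \<Rightarrow> 'b"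
    by (rule linear_on_set)
  have "on_set X ` (\<Union>d. fun_space.span (monomial_funs cs d)) \<subseteq> on_set X ` polyfuns cs"
    unfolding polyfuns_eq_span by (intro image_mono UN_least fun_space.span_mono) auto
  moreover have "fun_space.subspace (on_set X ` polyfuns cs)"
    by (rule r.subspace_image) (rule subspace_polyfuns)
  ultimately have "regular_maps (*) cs X \<subseteq> on_set X ` polyfuns cs"
    unfolding regular_maps_def homogeneous_maps_eq
    by (intro fun_space.span_minimal) (auto simp: image_UN)
  moreover have "on_set X ` polyfuns cs \<subseteq> regular_maps (*) cs X"
    unfolding regular_maps_def homogeneous_maps_eq polyfuns_eq_span r.span_image[symmetric]
    by (intro fun_space.span_mono) (auto intro: fun_space.span_base)
  ultimately show ?thesis by blast
qed

lemma regular_maps_iff: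
  "F \<in> regular_maps (*) cs X \<longleftrightarrow> F \<in> polyfuns_on cs X \<and> (\<forall>x. x \<notin> X \<longrightarrow> F x = 0)"
  unfolding regular_maps_eq polyfuns_on_def on_set_def image_def by (auto simp: fun_eq_iff)

section \<open>Two-by-two matrices\<close>

definition mat22 :: "'k \<Rightarrow> 'k \<Rightarrow> 'k \<Rightarrow> 'k \<Rightarrow> 'k::zero mat2" where
  "mat22 a b c d = (\<chi> i j. if i = 1 then (if j = 1 then a else b) else (if j = 1 then c else d))"

lemma mat22_nth [simp]:
  "mat22 a b c d $ 1 $ 1 = a" "mat22 a b c d $ 1 $ 2 = b"
  "mat22 a b c d $ 2 $ 1 = c" "mat22 a b c d $ 2 $ 2 = d"
  by (simp_all add: mat22_def)

lemma mat2_eq_iff: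
  "A = B \<longleftrightarrow> A $ 1 $ 1 = B $ 1 $ 1 \<and> A $ 1 $ 2 = B $ 1 $ 2 \<and> A $ 2 $ 1 = B $ 2 $ 1 \<and> A $ 2 $ 2 = B $ 2 $ 2"
  for A :: "'k mat2"
  by (auto simp: vec_eq_iff forall_2)

lemma mat2_mult_nth: "(A ** B) $ i $ j = A $ i $ 1 * B $ 1 $ j + A $ i $ 2 * B $ 2 $ j"
  for A :: "'k::comm_ring_1 mat2"
  by (simp add: matrix_matrix_mult_def sum_2)

lemma mat_1_nth [simp]:
  "(mat 1 :: 'k::comm_ring_1 mat2) $ 1 $ 1 = 1" "(mat 1 :: 'k mat2) $ 1 $ 2 = 0"
  "(mat 1 :: 'k mat2) $ 2 $ 1 = 0" "(mat 1 :: 'k mat2) $ 2 $ 2 = 1"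
  by (simp_all add: mat_def)

lemma torus_eq: "torus s = mat22 s 0 0 (inverse s)"
  by (simp add: mat2_eq_iff torus_def)

lemma SL2_iff: "g \<in> SL2 \<longleftrightarrow> g $ 1 $ 1 * g $ 2 $ 2 - g $ 1 $ 2 * g $ 2 $ 1 = 1"
  by (simp add: SL2_def det_2)

lemma SL2_mult: "g \<in> SL2 \<Longrightarrow> h \<in> SL2 \<Longrightarrow> g ** h \<in> SL2"
  by (simp add: SL2_def det_mul)

lemma torus_SL2: "s \<noteq> 0 \<Longrightarrow> torus s \<in> SL2"
  by (simp add: SL2_iff torus_eq)

text \<open>\<open>matrix_inv\<close> is defined by choice; uniqueness of two-sided inverses
  identifies it with the adjugate.\<close>

lemma SL2_inverse:
  assumes "g \<in> SL2"
  shows "matrix_inv g = mat22 (g $ 2 $ 2) (- g $ 1 $ 2) (- g $ 2 $ 1) (g $ 1 $ 1)" (is "_ = ?h")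
proof -
  have 1: "g ** ?h = mat 1" "?h ** g = mat 1"
    using assms by (auto simp: SL2_iff mat2_eq_iff mat2_mult_nth algebra_simps)
  have "g ** matrix_inv g = mat 1 \<and> matrix_inv g ** g = mat 1"
    unfolding matrix_inv_def by (rule someI[of _ ?h]) (use 1 in auto)
  then have "matrix_inv g = (matrix_inv g ** g) ** ?h"
    by (metis 1(1) matrix_mul_assoc matrix_mul_rid)
  then show ?thesis
    using \<open>g ** matrix_inv g = mat 1 \<and> matrix_inv g ** g = mat 1\<close> by (simp add: matrix_mul_lid)
qed

lemma torus_inverse: "s \<noteq> 0 \<Longrightarrow> matrix_inv (torus s) = mat22 (inverse s) 0 0 s"
  by (simp add: SL2_inverse torus_SL2) (simp add: torus_eq)

lemma SL2_inverse_SL2: "g \<in> SL2 \<Longrightarrow> matrix_inv g \<in> SL2"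
  by (simp add: SL2_inverse SL2_iff algebra_simps)

lemma Bneg_iff: "b \<in> Bneg \<longleftrightarrow> b $ 1 $ 2 = 0 \<and> b $ 1 $ 1 * b $ 2 $ 2 = 1"
  by (auto simp: Bneg_def SL2_iff)

lemma Bneg_SL2: "b \<in> Bneg \<Longrightarrow> b \<in> SL2"
  by (simp add: Bneg_def)

lemma Bneg_mult: "b \<in> Bneg \<Longrightarrow> c \<in> Bneg \<Longrightarrow> b ** c \<in> Bneg"
  by (simp add: Bneg_def SL2_mult mat2_mult_nth)

lemma Bneg_nonzero: "b \<in> Bneg \<Longrightarrow> b $ 2 $ 2 \<noteq> 0" "b \<in> Bneg \<Longrightarrow> b $ 1 $ 1 \<noteq> 0"
  by (auto simp: Bneg_iff)

section \<open>The cochain complex of a line bundle\<close>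

definition cochains :: "int \<Rightarrow> nat \<Rightarrow> ('k::field mat2 \<times> 'k mat2 list \<Rightarrow> 'k) set" where
  "cochains w n = ind_cochains (*) (\<lambda>b z. (b $ 1 $ 1) powi w * z) n"

lemma mem_GB_points: "(g, bs) \<in> GB_points n \<longleftrightarrow> g \<in> SL2 \<and> length bs = Suc n \<and> set bs \<subseteq> Bneg"
  by (auto simp: GB_points_def)

lemma GB_coords_cases:
  assumes "c \<in> GB_coords n"
  obtains (G) i j where "c = (\<lambda>x. fst x $ i $ j)" | (B) l i j where "l \<le> n" "c = (\<lambda>x. snd x ! l $ i $ j)"
  using assms unfolding GB_coords_def case_prod_beta'
  by (elim UnE CollectE exE conjE) (rule G, assumption, rule B)

lemma polyfuns_G: "(\<lambda>x. fst x $ i $ j) \<in> polyfuns_on (GB_coords n) X"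
  by (rule polyfuns_on_coord) (auto simp: GB_coords_def case_prod_beta')

lemma polyfuns_B: "l \<le> n \<Longrightarrow> (\<lambda>x. snd x ! l $ i $ j) \<in> polyfuns_on (GB_coords n) X"
  unfolding GB_coords_def case_prod_beta'
  by (rule polyfuns_on_coord, rule UnI2, rule CollectI, intro exI conjI, rule refl)

text \<open>Equivariance involves the action of the inverse of b, whose upper left entry is b_22.
  Hence weight w appears as a power of b_22, and sections are modelled on the second column of
  g.\<close>

lemma cochains_iff:
  "F \<in> cochains w n \<longleftrightarrow>
    F \<in> polyfuns_on (GB_coords n) (GB_points n) \<and> (\<forall>x. x \<notin> GB_points n \<longrightarrow> F x = 0) \<and>
    (\<forall>g bs b. (g, bs) \<in> GB_points n \<longrightarrow> b \<in> Bneg \<longrightarrow>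
      F (g ** b, bs) = (b $ 2 $ 2) powi w * F (g, map ((**) b) bs))"
proof -
  have "(\<forall>(g, bs)\<in>GB_points n. \<forall>b\<in>Bneg.
      F (g ** b, bs) = (matrix_inv b $ 1 $ 1) powi w * F (g, map ((**) b) bs)) \<longleftrightarrow>
    (\<forall>g bs b. (g, bs) \<in> GB_points n \<longrightarrow> b \<in> Bneg \<longrightarrow>
      F (g ** b, bs) = (b $ 2 $ 2) powi w * F (g, map ((**) b) bs))"
    by (auto simp: SL2_inverse Bneg_SL2)
  then show ?thesis
    unfolding cochains_def ind_cochains_def regular_maps_iff by blast
qed

lemma cochains_outside: "F \<in> cochains w n \<Longrightarrow> x \<notin> GB_points n \<Longrightarrow> F x = 0"
  unfolding cochains_iff by blast

lemma cochains_equivariant: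
  "F \<in> cochains w n \<Longrightarrow> (g, bs) \<in> GB_points n \<Longrightarrow> b \<in> Bneg \<Longrightarrow>
    F (g ** b, bs) = (b $ 2 $ 2) powi w * F (g, map ((**) b) bs)"
  by (simp add: cochains_iff)

lemma cochainsI:
  assumes "F \<in> polyfuns_on (GB_coords n) (GB_points n)" "\<And>x. x \<notin> GB_points n \<Longrightarrow> F x = 0"
    and "\<And>g bs b. (g, bs) \<in> GB_points n \<Longrightarrow> b \<in> Bneg \<Longrightarrow>
      F (g ** b, bs) = (b $ 2 $ 2) powi w * F (g, map ((**) b) bs)"
  shows "F \<in> cochains w n"
  unfolding cochains_iff using assms by blast

lemma cochains_add: "F \<in> cochains w n \<Longrightarrow> G \<in> cochains w n \<Longrightarrow> (\<lambda>x. F x + G x) \<in> cochains w n"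
  by (auto simp: cochains_iff distrib_left intro: polyfuns_on_add)

lemma cochains_minus: "F \<in> cochains w n \<Longrightarrow> (\<lambda>x. - F x) \<in> cochains w n"
  by (auto simp: cochains_iff intro: polyfuns_on_minus)

lemma cochains_diff: "F \<in> cochains w n \<Longrightarrow> G \<in> cochains w n \<Longrightarrow> (\<lambda>x. F x - G x) \<in> cochains w n"
  using cochains_add[OF _ cochains_minus, of F w n G] by simp

lemma cochains_sum:
  "(\<And>i. i \<in> I \<Longrightarrow> F i \<in> cochains w n) \<Longrightarrow> (\<lambda>x. \<Sum>i\<in>I. F i x) \<in> cochains w n"
  by (auto simp: cochains_iff sum_distrib_left intro: polyfuns_on_sum)

lemma cochains_scale: "F \<in> cochains w n \<Longrightarrow> (\<lambda>x. c * F x) \<in> cochains w n"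
  by (auto simp: cochains_iff intro: polyfuns_on_mult polyfuns_on_const)

lemma cochains_mult:
  "F \<in> cochains w n \<Longrightarrow> G \<in> cochains w' n \<Longrightarrow> (\<lambda>x. F x * G x) \<in> cochains (w + w') n"
  by (auto simp: cochains_iff power_int_add Bneg_nonzero intro: polyfuns_on_mult)

text \<open>Because b is lower triangular, the second column of \<open>g ** b\<close> is b_22 times
  that of g. Its entries therefore have weight 1.\<close>

lemma cochains_column:
  fixes F :: "'k::field mat2 \<times> 'k mat2 list \<Rightarrow> 'k"
  assumes "F \<in> cochains w n"
  shows "(\<lambda>x. (fst x $ i $ 2) ^ N * F x) \<in> cochains (w + int N) n"
proof (rule cochainsI)
  show "(\<lambda>x. (fst x $ i $ 2) ^ N * F x) \<in> polyfuns_on (GB_coords n) (GB_points n)"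
    using assms by (intro polyfuns_on_mult polyfuns_on_power polyfuns_G) (simp add: cochains_iff)
next
  fix g b :: "'k mat2" and bs assume "(g, bs) \<in> GB_points n" "b \<in> Bneg"
  then show "(fst (g ** b, bs) $ i $ 2) ^ N * F (g ** b, bs) =
      (b $ 2 $ 2) powi (w + int N) * ((fst (g, map ((**) b) bs) $ i $ 2) ^ N * F (g, map ((**) b) bs))"
    using assms
    by (simp add: cochains_equivariant power_int_add Bneg_nonzero mat2_mult_nth Bneg_iff power_mult_distrib)
qed (simp add: cochains_outside[OF assms])

declare sum.atMost_Suc [simp del]

section \<open>Faces and the differential\<close>

definition omit :: "nat \<Rightarrow> 'a list \<Rightarrow> 'a list" where
  "omit i xs = take i xs @ drop (Suc i) xs"

lemma length_omit: "i < length xs \<Longrightarrow> length (omit i xs) = length xs - 1"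
  by (simp add: omit_def)

lemma set_omit: "set (omit i xs) \<subseteq> set xs"
  using set_take_subset set_drop_subset by (fastforce simp: omit_def)

lemma map_omit: "map f (omit i xs) = omit i (map f xs)"
  by (simp add: omit_def take_map drop_map)

lemma omit_nth: "i < length xs \<Longrightarrow> l < length xs - 1 \<Longrightarrow> omit i xs ! l = xs ! (if l < i then l else Suc l)"
  by (auto simp: omit_def nth_append min_def)

lemma omit_Cons [simp]: "omit 0 (x # xs) = xs" "omit (Suc i) (x # xs) = x # omit i xs"
  by (simp_all add: omit_def)

text \<open>The simplicial identity for face maps, on which the vanishing of the squared
  differential rests.\<close>

lemma omit_omit:
  assumes "j < i" "i < length xs"
  shows "omit j (omit i xs) = omit (i - 1) (omit j xs)"
  using assms by (intro nth_equalityI) (auto simp: omit_nth length_omit)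

lemma omit_GB_points: "(g, bs) \<in> GB_points (Suc n) \<Longrightarrow> i \<le> Suc n \<Longrightarrow> (g, omit i bs) \<in> GB_points n"
  using set_omit[of i bs] by (auto simp: mem_GB_points length_omit)

lemma ind_diff_eq:
  fixes F :: "'k::field mat2 \<times> 'k mat2 list \<Rightarrow> 'v::ring_1"
  assumes "(g, bs) \<in> GB_points (Suc n)"
  shows "ind_diff n F (g, bs) = (\<Sum>i\<le>Suc n. (- 1) ^ i * F (g, omit i bs))"
proof -
  have "ind_diff n F (g, bs) =
      (\<Sum>i\<le>Suc n. if even i then F (g, omit i bs) else - F (g, omit i bs))"
    unfolding ind_diff_def omit_def using assms by simp
  also have "\<dots> = (\<Sum>i\<le>Suc n. (- 1) ^ i * F (g, omit i bs))"
    by (rule sum.cong) auto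
  finally show ?thesis .
qed

lemma ind_diff_outside: "x \<notin> GB_points (Suc n) \<Longrightarrow> ind_diff n F x = 0"
  by (auto simp: ind_diff_def split: prod.splits)

lemma ind_diff_eqI:
  fixes F :: "'k::field mat2 \<times> 'k mat2 list \<Rightarrow> 'v::ring_1"
  assumes "\<And>x. x \<notin> GB_points (Suc n) \<Longrightarrow> G x = 0"
    and "\<And>g bs. (g, bs) \<in> GB_points (Suc n) \<Longrightarrow> (\<Sum>i\<le>Suc n. (- 1) ^ i * F (g, omit i bs)) = G (g, bs)"
  shows "ind_diff n F = G"
proof
  fix x
  show "ind_diff n F x = G x"
    by (cases x; cases "x \<in> GB_points (Suc n)") (simp_all add: ind_diff_outside ind_diff_eq assms)
qed

text \<open>The differential changes only the arguments in \<open>B\<close>, so functions of g alone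
  behave like scalars. In particular multiplication by powers of u and v commutes with it.\<close>

lemma ind_diff_mult_G:
  fixes F :: "'k::field mat2 \<times> 'k mat2 list \<Rightarrow> 'k"
  shows "ind_diff n (\<lambda>x. h (fst x) * F x) = (\<lambda>x. h (fst x) * ind_diff n F x)"
  by (rule ind_diff_eqI) (auto simp: ind_diff_outside ind_diff_eq sum_distrib_left mult_ac)

lemma ind_diff_diff:
  fixes F G :: "'k::field mat2 \<times> 'k mat2 list \<Rightarrow> 'k"
  shows "ind_diff n (\<lambda>x. F x - G x) = (\<lambda>x. ind_diff n F x - ind_diff n G x)"
  by (rule ind_diff_eqI)
    (auto simp: ind_diff_outside ind_diff_eq sum_subtractf right_diff_distrib)

lemma ind_diff_cong:
  fixes F G :: "'k::field mat2 \<times> 'k mat2 list \<Rightarrow> 'k"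
  assumes "\<And>x. x \<in> GB_points n \<Longrightarrow> F x = G x"
  shows "ind_diff n F = ind_diff n G"
  by (rule ind_diff_eqI) (auto simp: ind_diff_outside ind_diff_eq omit_GB_points assms intro!: sum.cong)

lemma ind_diff_ind_diff:
  fixes F :: "'k::field mat2 \<times> 'k mat2 list \<Rightarrow> 'k"
  shows "ind_diff (Suc n) (ind_diff n F) = 0"
proof (rule ind_diff_eqI)
  fix g :: "'k mat2" and bs assume pt: "(g, bs) \<in> GB_points (Suc (Suc n))"
  then have len: "length bs = Suc (Suc (Suc n))"
    by (simp add: mem_GB_points)
  let ?h = "\<lambda>(i, j). (- 1) ^ (i + j) * F (g, omit j (omit i bs))"
  let ?A = "{(i, j). i \<le> Suc (Suc n) \<and> j < i}" and ?B = "{(i, j). i \<le> j \<and> j \<le> Suc n}"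
  have fin: "finite ?A" "finite ?B"
    by (rule finite_subset[of _ "{..Suc (Suc n)} \<times> {..Suc (Suc n)}"]; force)+
  have "(\<Sum>i\<le>Suc (Suc n). (- 1) ^ i * ind_diff n F (g, omit i bs)) =
      (\<Sum>i\<le>Suc (Suc n). \<Sum>j\<le>Suc n. ?h (i, j))"
  proof (rule sum.cong)
    fix i assume "i \<in> {..Suc (Suc n)}"
    then have "(g, omit i bs) \<in> GB_points (Suc n)"
      using omit_GB_points[OF pt] by simp
    from ind_diff_eq[OF this, of F]
    show "(- 1) ^ i * ind_diff n F (g, omit i bs) = (\<Sum>j\<le>Suc n. ?h (i, j))"
      by (simp add: sum_distrib_left power_add mult.assoc)
  qed simp
  also have "\<dots> = (\<Sum>x\<in>{..Suc (Suc n)} \<times> {..Suc n}. ?h x)"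
    by (simp add: sum.cartesian_product)
  also have "{..Suc (Suc n)} \<times> {..Suc n} = ?A \<union> ?B"
    by auto
  also have "(\<Sum>x\<in>?A \<union> ?B. ?h x) = (\<Sum>x\<in>?A. ?h x) + (\<Sum>x\<in>?B. ?h x)"
    using fin by (intro sum.union_disjoint) auto
  also have "(\<Sum>x\<in>?A. ?h x) = (\<Sum>x\<in>?B. - ?h x)"
  \<comment> \<open>By the simplicial identity the term (i, j) with j < i omits the same two
    arguments as (j, i - 1). The exponent of the sign drops by one, so the two terms cancel.\<close>
  proof (rule sum.reindex_bij_witness[of _ "\<lambda>(i, j). (Suc j, i)" "\<lambda>(i, j). (j, i - 1)"])
    fix x assume x: "x \<in> ?A"
    obtain i j where ij: "x = (i, j)" "j < i" "i \<le> Suc (Suc n)"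
      using x by auto
    then have "omit j (omit i bs) = omit (i - 1) (omit j bs)"
      by (intro omit_omit) (auto simp: len)
    moreover have "(- 1 :: 'k) ^ (i + j) = - ((- 1) ^ (j + (i - 1)))"
      using ij by (cases i) (auto simp: add.commute)
    ultimately show "- ?h (case x of (i, j) \<Rightarrow> (j, i - 1)) = ?h x"
      by (simp add: ij(1))
  qed auto
  finally show "(\<Sum>i\<le>Suc (Suc n). (- 1) ^ i * ind_diff n F (g, omit i bs)) = 0 (g, bs)"
    by (simp add: sum_negf)
qed simp

lemma ind_diff_cochains:
  fixes F :: "'k::field mat2 \<times> 'k mat2 list \<Rightarrow> 'k"
  assumes "F \<in> cochains w n"
  shows "ind_diff n F \<in> cochains w (Suc n)"
proof (rule cochainsI)
  have "(\<lambda>x. F (fst x, omit i (snd x))) \<in> polyfuns_on (GB_coords (Suc n)) (GB_points (Suc n))"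
    if i: "i \<le> Suc n" for i
  proof (rule polyfuns_on_comp[where f = F])
    show "F \<in> polyfuns_on (GB_coords n) (GB_points n)"
      using assms by (simp add: cochains_iff)
    show "(\<lambda>x. (fst x, omit i (snd x))) ` GB_points (Suc n) \<subseteq> GB_points n"
      using i omit_GB_points by fastforce
    fix c assume "c \<in> (GB_coords n :: ('k mat2 \<times> 'k mat2 list \<Rightarrow> 'k) set)"
    then show "(\<lambda>x. c (fst x, omit i (snd x))) \<in> polyfuns_on (GB_coords (Suc n)) (GB_points (Suc n))"
    proof (cases rule: GB_coords_cases)
      case (G a b)
      then show ?thesis by (simp add: polyfuns_G)
    next
      case (B l a b)
      show ?thesis
        by (rule polyfuns_on_cong[OF polyfuns_B[of "if l < i then l else Suc l" _ a b]])
          (use B i in \<open>auto simp: GB_points_def omit_nth\<close>)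
    qed
  qed
  then have "(\<lambda>x. \<Sum>i\<le>Suc n. (- 1) ^ i * F (fst x, omit i (snd x)))
      \<in> polyfuns_on (GB_coords (Suc n)) (GB_points (Suc n))"
    by (intro polyfuns_on_sum polyfuns_on_mult polyfuns_on_const) auto
  then show "ind_diff n F \<in> polyfuns_on (GB_coords (Suc n)) (GB_points (Suc n))"
    by (rule polyfuns_on_cong) (auto simp: ind_diff_eq)
next
  fix g b :: "'k mat2" and bs assume *: "(g, bs) \<in> GB_points (Suc n)" "b \<in> Bneg"
  then have "(g ** b, bs) \<in> GB_points (Suc n)" "(g, map ((**) b) bs) \<in> GB_points (Suc n)"
    by (auto simp: mem_GB_points SL2_mult Bneg_SL2 Bneg_mult)
  then show "ind_diff n F (g ** b, bs) = b $ 2 $ 2 powi w * ind_diff n F (g, map ((**) b) bs)"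
    using * assms
    by (auto simp: ind_diff_eq sum_distrib_left cochains_equivariant[OF assms] omit_GB_points
        map_omit mult.left_commute intro!: sum.cong)
qed (simp add: ind_diff_outside)

text \<open>Where \<open>g $ i $ 2\<close> is nonzero, \<open>g ** coset_normalizer i g\<close> is the unique matrix in the coset
  \<open>g B\<close> with row \<open>i\<close> equal to \<open>(0, 1)\<close>.\<close>

definition coset_normalizer :: "2 \<Rightarrow> 'k::field mat2 \<Rightarrow> 'k mat2" where
  "coset_normalizer i g = mat22 (g $ i $ 2) 0 (- g $ i $ 1) (inverse (g $ i $ 2))"

lemma coset_normalizer_Bneg: "g $ i $ 2 \<noteq> 0 \<Longrightarrow> coset_normalizer i g \<in> Bneg"
  by (simp add: coset_normalizer_def Bneg_iff)

text \<open>The matrices g and \<open>g ** b\<close> lie in the same coset, so their normalized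
  representatives agree; cancelling g gives the equation. It is what makes the homotopy
  equivariant.\<close>

lemma coset_normalizer_mult:
  assumes "b \<in> Bneg" "g $ i $ 2 \<noteq> 0"
  shows "b ** coset_normalizer i (g ** b) = coset_normalizer i g"
proof -
  have b: "b $ 1 $ 2 = 0" "b $ 1 $ 1 * b $ 2 $ 2 = 1"
    using assms(1) by (auto simp: Bneg_iff)
  have "b $ 2 $ 1 * (g $ i $ 2 * b $ 2 $ 2) + b $ 2 $ 2 * (- (g $ i $ 1 * b $ 1 $ 1) - g $ i $ 2 * b $ 2 $ 1)
      = - (g $ i $ 1 * (b $ 1 $ 1 * b $ 2 $ 2))"
    by (simp add: algebra_simps)
  moreover have "b $ 2 $ 2 \<noteq> 0"
    using assms(1) by (rule Bneg_nonzero)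
  ultimately show ?thesis
    using b assms(2) by (simp add: coset_normalizer_def mat2_eq_iff mat2_mult_nth)
qed

text \<open>Inserting \<^const>\<open>coset_normalizer\<close> is a contracting homotopy away from \<open>g $ i $ 2 = 0\<close>; a
  power of \<open>g $ i $ 2\<close> clears the poles.\<close>

lemma cocycle_times_column_power:
  fixes F :: "'k::field mat2 \<times> 'k mat2 list \<Rightarrow> 'k"
  assumes F: "F \<in> cochains w (Suc n)" and cocycle: "ind_diff (Suc n) F = 0"
  shows "\<exists>N0. \<forall>N\<ge>N0. \<exists>P\<in>cochains (w + int N) n. ind_diff n P = (\<lambda>x. (fst x $ i $ 2) ^ N * F x)"
proof -
  define u :: "'k mat2 \<times> 'k mat2 list \<Rightarrow> 'k" where "u = (\<lambda>x. fst x $ i $ 2)"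
  define \<phi> :: "'k mat2 \<times> 'k mat2 list \<Rightarrow> 'k mat2 \<times> 'k mat2 list"
    where "\<phi> = (\<lambda>x. (fst x, coset_normalizer i (fst x) # snd x))"
  have u: "u \<in> polyfuns_on (GB_coords n) (GB_points n)"
    unfolding u_def by (rule polyfuns_G)
  have \<phi>: "\<phi> x \<in> GB_points (Suc n)" if "x \<in> GB_points n" "u x \<noteq> 0" for x
    using that coset_normalizer_Bneg[of "fst x" i] by (auto simp: \<phi>_def GB_points_def u_def)
  obtain p where p: "p \<in> polyfuns (GB_coords (Suc n))" "\<And>x. x \<in> GB_points (Suc n) \<Longrightarrow> F x = p x"
    using F by (auto simp: cochains_iff polyfuns_on_def)
  have "\<exists>N. \<forall>M\<ge>N. (\<lambda>x. u x ^ M * p (\<phi> x)) \<in> polyfuns_on (GB_coords n) (GB_points n)"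
  proof (rule polyfuns_on_comp_pole[OF p(1) u])
    fix c assume "c \<in> (GB_coords (Suc n) :: ('k mat2 \<times> 'k mat2 list \<Rightarrow> 'k) set)"
    then show "\<exists>N. \<forall>M\<ge>N. (\<lambda>x. u x ^ M * c (\<phi> x)) \<in> polyfuns_on (GB_coords n) (GB_points n)"
    proof (cases rule: GB_coords_cases)
      case (G a b)
      then show ?thesis
        by (auto simp: \<phi>_def intro!: polyfuns_on_mult polyfuns_on_power u polyfuns_G)
    next
      case (B l a b)
      show ?thesis
      proof (cases l)
        case 0
        \<comment> \<open>The product of u^M with \<open>inverse u\<close> has to equal u^(M - 1)
          everywhere. Where u = 0 it is 0, as \<open>inverse 0 = 0\<close>, so M - 1 must be
          positive.\<close>
        have "(\<lambda>x. u x ^ M * c (\<phi> x)) \<in> polyfuns_on (GB_coords n) (GB_points n)" if M: "M \<ge> 2" for M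
        proof -
          have inv: "u x ^ M * inverse (u x) = u x ^ (M - 1)" for x
            using M by (cases M; cases "u x = 0") (auto simp: power_0_left)
          have inv': "(\<lambda>x. u x ^ M * inverse (u x)) \<in> polyfuns_on (GB_coords n) (GB_points n)"
            unfolding inv by (intro polyfuns_on_power u)
          have mult_u: "(\<lambda>x. u x ^ M * t x) \<in> polyfuns_on (GB_coords n) (GB_points n)"
            if "t \<in> polyfuns_on (GB_coords n) (GB_points n)" for t
            by (intro polyfuns_on_mult polyfuns_on_power u that)
          have "(\<lambda>x. u x ^ M * mat22 (u x) 0 (- fst x $ i $ 1) (inverse (u x)) $ a $ b)
              \<in> polyfuns_on (GB_coords n) (GB_points n)"
            using exhaust_2[of a] exhaust_2[of b] inv' mult_u[OF u] mult_u[OF polyfuns_on_const[of 0]]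
              mult_u[OF polyfuns_on_minus[OF polyfuns_G[of i 1]]] by auto
          then show ?thesis
            by (simp add: B 0 \<phi>_def coset_normalizer_def u_def)
        qed
        then show ?thesis by blast
      next
        case (Suc l')
        then show ?thesis
          using B by (auto simp: \<phi>_def intro!: polyfuns_on_mult polyfuns_on_power u polyfuns_B)
      qed
    qed
  qed
  then obtain N1 where N1: "\<And>M. M \<ge> N1 \<Longrightarrow> (\<lambda>x. u x ^ M * p (\<phi> x)) \<in> polyfuns_on (GB_coords n) (GB_points n)"
    by blast
  \<comment> \<open>The extra one keeps N positive. Where u = 0 the point \<open>\<phi> x\<close>
    leaves the domain and F may differ from its polynomial p, but there the factor u^N
    vanishes.\<close>
  have "\<exists>P\<in>cochains (w + int N) n. ind_diff n P = (\<lambda>x. u x ^ N * F x)" if N: "N \<ge> Suc N1" for N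
  proof
    define P where "P = on_set (GB_points n) (\<lambda>x. u x ^ N * F (\<phi> x))"
    show "P \<in> cochains (w + int N) n"
    proof (rule cochainsI)
      show "P \<in> polyfuns_on (GB_coords n) (GB_points n)"
      proof (rule polyfuns_on_cong[OF N1])
        show "N1 \<le> N" using N by simp
        show "P x = u x ^ N * p (\<phi> x)" if "x \<in> GB_points n" for x
          using that p(2)[OF \<phi>[OF that]] N by (cases "u x = 0") (auto simp: P_def)
      qed
      show "P x = 0" if "x \<notin> GB_points n" for x
        using that by (simp add: P_def)
      fix g b :: "'k mat2" and bs assume pt: "(g, bs) \<in> GB_points n" and b: "b \<in> Bneg"
      then have pts: "(g ** b, bs) \<in> GB_points n" "(g, map ((**) b) bs) \<in> GB_points n"
        by (auto simp: mem_GB_points SL2_mult Bneg_SL2 Bneg_mult)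
      have ub: "u (g ** b, bs) = u (g, bs) * b $ 2 $ 2" "u (g, map ((**) b) bs) = u (g, bs)"
        using b by (simp_all add: u_def mat2_mult_nth Bneg_iff)
      show "P (g ** b, bs) = b $ 2 $ 2 powi (w + int N) * P (g, map ((**) b) bs)"
      proof (cases "u (g, bs) = 0")
        case True
        then show ?thesis
          using pts N by (simp add: P_def ub)
      next
        case False
        then have c: "coset_normalizer i (g ** b) \<in> Bneg"
          using ub Bneg_nonzero[OF b] by (intro coset_normalizer_Bneg) (simp add: u_def)
        have "F (g ** b, coset_normalizer i (g ** b) # bs) =
            b $ 2 $ 2 powi w * F (g, map ((**) b) (coset_normalizer i (g ** b) # bs))"
          using c pt b by (intro cochains_equivariant[OF F]) (auto simp: mem_GB_points)
        also have "map ((**) b) (coset_normalizer i (g ** b) # bs) = coset_normalizer i g # map ((**) b) bs"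
          using False coset_normalizer_mult[OF b, of g i] by (simp add: u_def)
        finally show ?thesis
          using pts Bneg_nonzero[OF b]
          by (simp add: P_def \<phi>_def ub power_int_add power_mult_distrib)
      qed
    qed
    show "ind_diff n P = (\<lambda>x. u x ^ N * F x)"
    proof (rule ind_diff_eqI)
      show "u x ^ N * F x = 0" if "x \<notin> GB_points (Suc n)" for x
        using cochains_outside[OF F that] by simp
      fix g :: "'k mat2" and bs assume pt: "(g, bs) \<in> GB_points (Suc n)"
      have "(\<Sum>i\<le>Suc n. (- 1) ^ i * P (g, omit i bs)) =
          (\<Sum>j\<le>Suc n. u (g, bs) ^ N * ((- 1) ^ j * F (g, coset_normalizer i g # omit j bs)))"
        using omit_GB_points[OF pt]
        by (intro sum.cong) (auto simp: P_def \<phi>_def u_def)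
      also have "\<dots> = u (g, bs) ^ N * F (g, bs)"
      proof (cases "u (g, bs) = 0")
        case True
        then show ?thesis using N by (simp add: power_0_left)
      next
        case False
        then have "(g, coset_normalizer i g # bs) \<in> GB_points (Suc (Suc n))"
          using pt coset_normalizer_Bneg[of g i] by (auto simp: mem_GB_points u_def)
        \<comment> \<open>In the cocycle condition at the enlarged tuple, face 0 returns F(g, bs).
          The remaining faces keep the inserted element in front and carry a shifted sign.\<close>
        from ind_diff_eq[OF this, of F] have
          "F (g, bs) = (\<Sum>j\<le>Suc n. (- 1) ^ j * F (g, coset_normalizer i g # omit j bs))"
          by (simp add: cocycle sum.atMost_Suc_shift[of _ "Suc n"] sum_negf)
        then show ?thesis
          by (simp add: sum_distrib_left)
      qed
      finally show "(\<Sum>i\<le>Suc n. (- 1) ^ i * P (g, omit i bs)) = u (g, bs) ^ N * F (g, bs)" .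
    qed
  qed
  then show ?thesis
    unfolding u_def by blast
qed

text \<open>The first columns of \<open>g b\<^sub>0\<close>, rescaled to weight \<open>-1\<close>, provide a partition of unity.\<close>

lemma partition_of_unity:
  shows "\<exists>A\<in>cochains (- int N) n. \<exists>B\<in>cochains (- int M) n.
    \<forall>x\<in>GB_points n. A x * (fst x $ 2 $ 2 :: 'k::field) ^ N + B x * (fst x $ 1 $ 2) ^ M = 1"
proof -
  \<comment> \<open>Both F(g b, bs) and F(g, b bs) see the same product g b b_0, so its first column
    contributes no weight. The factor (b_0)_22 is multiplied by b_22 on one side only, which gives
    weight -1.\<close>
  define C where "C i = on_set (GB_points n)
    (\<lambda>x. (fst x ** (snd x ! 0)) $ i $ 1 * (snd x ! 0) $ 2 $ 2 :: 'k)" for i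
  have C: "C i \<in> cochains (- 1) n" for i
  proof (rule cochainsI)
    show "C i \<in> polyfuns_on (GB_coords n) (GB_points n)"
      by (rule polyfuns_on_cong[where f = "\<lambda>x. (fst x $ i $ 1 * (snd x ! 0) $ 1 $ 1 +
          fst x $ i $ 2 * (snd x ! 0) $ 2 $ 1) * (snd x ! 0) $ 2 $ 2"])
        (auto simp: C_def mat2_mult_nth intro!: polyfuns_on_mult polyfuns_on_add polyfuns_G polyfuns_B)
    fix g b :: "'k mat2" and bs assume pt: "(g, bs) \<in> GB_points n" and b: "b \<in> Bneg"
    then have pts: "(g ** b, bs) \<in> GB_points n" "(g, map ((**) b) bs) \<in> GB_points n"
      by (auto simp: mem_GB_points SL2_mult Bneg_SL2 Bneg_mult)
    have "bs ! 0 \<in> Bneg"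
      using pt by (auto simp: mem_GB_points)
    then have "map ((**) b) bs ! 0 = b ** (bs ! 0)" "(bs ! 0) $ 1 $ 2 = 0"
      using pt by (auto simp: mem_GB_points Bneg_iff)
    then show "C i (g ** b, bs) = b $ 2 $ 2 powi - 1 * C i (g, map ((**) b) bs)"
      using pts Bneg_nonzero[OF b] by (simp add: C_def matrix_mul_assoc mat2_mult_nth[of b])
  qed (simp add: C_def)
  have one: "on_set (GB_points n) (\<lambda>_. 1 :: 'k) \<in> cochains 0 n"
    by (rule cochainsI)
      (auto simp: mem_GB_points SL2_mult Bneg_SL2 Bneg_mult on_set_def
        intro: polyfuns_on_cong[OF polyfuns_on_const[of 1]])
  \<comment> \<open>This is det (g b_0) = 1, with the second column of g b_0 written as (b_0)_22
    times that of g.\<close>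
  have unit: "C 1 x * (fst x $ 2 $ 2) - C 2 x * (fst x $ 1 $ 2) = 1" if x: "x \<in> GB_points n" for x
  proof -
    obtain g bs where gbs: "x = (g, bs)" by (cases x)
    have "bs ! 0 \<in> Bneg" "g \<in> SL2"
      using x by (auto simp: gbs mem_GB_points)
    then have 0: "(bs ! 0) $ 1 $ 2 = 0" and "g ** (bs ! 0) \<in> SL2"
      by (simp add: Bneg_iff, simp add: SL2_mult Bneg_SL2)
    then have "(g ** (bs ! 0)) $ 1 $ 1 * (g ** (bs ! 0)) $ 2 $ 2 -
        (g ** (bs ! 0)) $ 1 $ 2 * (g ** (bs ! 0)) $ 2 $ 1 = 1"
      by (simp add: SL2_iff)
    then show ?thesis
      using x 0 by (simp add: C_def gbs mat2_mult_nth[of g _ _ 2] algebra_simps)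
  qed
  \<comment> \<open>Powers are reached one factor at a time by inserting the relation for exponent 1
    into the term with A. Here the exponent of u stays 1; the second induction raises it, inserting
    the relation obtained here into the term with B.\<close>
  have "\<exists>A\<in>cochains (- int N) n. \<exists>B\<in>cochains (- 1) n.
    \<forall>x\<in>GB_points n. A x * (fst x $ 2 $ 2 :: 'k) ^ N + B x * (fst x $ 1 $ 2) = 1" for N
  proof (induction N)
    case 0
    have "(\<lambda>_. 0) \<in> cochains (- 1) n"
      using cochains_sum[of "{}" _ "- 1" n] by simp
    then show ?case
      using one by (intro bexI[of _ "on_set (GB_points n) (\<lambda>_. 1)"] bexI[of _ "\<lambda>_. 0"]) auto
  next
    case (Suc N)
    then obtain A B where AB: "A \<in> cochains (- int N) n" "B \<in> cochains (- 1) n"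
      "\<And>x. x \<in> GB_points n \<Longrightarrow> A x * (fst x $ 2 $ 2 :: 'k) ^ N + B x * (fst x $ 1 $ 2) = 1"
      by blast
    have "(\<lambda>x. A x * C 1 x) \<in> cochains (- int (Suc N)) n"
      using cochains_mult[OF AB(1) C[of 1]] by (simp add: algebra_simps)
    moreover have "(\<lambda>x. B x - (fst x $ 2 $ 2) ^ N * (A x * C 2 x)) \<in> cochains (- 1) n"
      using cochains_column[OF cochains_mult[OF AB(1) C[of 2]], of 2 N] AB(2)
      by (intro cochains_diff) (auto simp: algebra_simps)
    moreover have "A x * C 1 x * (fst x $ 2 $ 2) ^ Suc N +
        (B x - (fst x $ 2 $ 2) ^ N * (A x * C 2 x)) * (fst x $ 1 $ 2) = 1" if x: "x \<in> GB_points n" for x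
    proof -
      have "A x * C 1 x * (fst x $ 2 $ 2) ^ Suc N +
          (B x - (fst x $ 2 $ 2) ^ N * (A x * C 2 x)) * (fst x $ 1 $ 2) =
          A x * (fst x $ 2 $ 2) ^ N * (C 1 x * (fst x $ 2 $ 2) - C 2 x * (fst x $ 1 $ 2)) +
          B x * (fst x $ 1 $ 2)"
        by (simp add: algebra_simps)
      then show ?thesis
        by (simp only: unit[OF x] mult_1_right AB(3)[OF x])
    qed
    ultimately show ?case
      by (intro bexI[of _ "\<lambda>x. A x * C 1 x"] bexI[of _ "\<lambda>x. B x - (fst x $ 2 $ 2) ^ N * (A x * C 2 x)"]) auto
  qed
  then obtain A' B' where A'B': "A' \<in> cochains (- int N) n" "B' \<in> cochains (- 1) n"
    "\<And>x. x \<in> GB_points n \<Longrightarrow> A' x * (fst x $ 2 $ 2 :: 'k) ^ N + B' x * (fst x $ 1 $ 2) = 1"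
    by meson
  show ?thesis
  proof (induction M)
    case 0
    have "(\<lambda>_. 0) \<in> cochains (- int N) n"
      using cochains_sum[of "{}" _ "- int N" n] by simp
    then show ?case
      using one by (intro bexI[of _ "\<lambda>_. 0"] bexI[of _ "on_set (GB_points n) (\<lambda>_. 1)"]) auto
  next
    case (Suc M)
    then obtain A B where AB: "A \<in> cochains (- int N) n" "B \<in> cochains (- int M) n"
      "\<And>x. x \<in> GB_points n \<Longrightarrow> A x * (fst x $ 2 $ 2 :: 'k) ^ N + B x * (fst x $ 1 $ 2) ^ M = 1"
      by blast
    have "(\<lambda>x. B x * B' x) \<in> cochains (- int (Suc M)) n"
      using cochains_mult[OF AB(2) A'B'(2)] by (simp add: algebra_simps)
    moreover have "(\<lambda>x. A x + (fst x $ 1 $ 2) ^ M * (B x * A' x)) \<in> cochains (- int N) n"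
      using cochains_column[OF cochains_mult[OF AB(2) A'B'(1)], of 1 M] AB(1)
      by (intro cochains_add) (auto simp: algebra_simps)
    moreover have "(A x + (fst x $ 1 $ 2) ^ M * (B x * A' x)) * (fst x $ 2 $ 2) ^ N +
        B x * B' x * (fst x $ 1 $ 2) ^ Suc M = 1" if x: "x \<in> GB_points n" for x
    proof -
      have "(A x + (fst x $ 1 $ 2) ^ M * (B x * A' x)) * (fst x $ 2 $ 2) ^ N +
          B x * B' x * (fst x $ 1 $ 2) ^ Suc M =
          A x * (fst x $ 2 $ 2) ^ N + B x * (fst x $ 1 $ 2) ^ M *
            (A' x * (fst x $ 2 $ 2) ^ N + B' x * (fst x $ 1 $ 2))"
        by (simp add: algebra_simps)
      then show ?thesis
        by (simp only: A'B'(3)[OF x] mult_1_right AB(3)[OF x])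
    qed
    ultimately show ?case
      by (intro bexI[of _ "\<lambda>x. A x + (fst x $ 1 $ 2) ^ M * (B x * A' x)"] bexI[of _ "\<lambda>x. B x * B' x"]) auto
  qed
qed

section \<open>Cohomology of line bundles\<close>

lemma ind_diff_add:
  fixes F G :: "'k::field mat2 \<times> 'k mat2 list \<Rightarrow> 'k"
  shows "ind_diff n (\<lambda>x. F x + G x) = (\<lambda>x. ind_diff n F x + ind_diff n G x)"
  by (rule ind_diff_eqI) (auto simp: ind_diff_outside ind_diff_eq sum.distrib distrib_left)

lemma ind_diff_scale:
  fixes F :: "'k::field mat2 \<times> 'k mat2 list \<Rightarrow> 'k"
  shows "ind_diff n (\<lambda>x. c * F x) = (\<lambda>x. c * ind_diff n F x)"
  using ind_diff_mult_G[of n "\<lambda>_. c" F] by simp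

lemma ind_diff_sum:
  fixes F :: "'i \<Rightarrow> 'k::field mat2 \<times> 'k mat2 list \<Rightarrow> 'k"
  shows "ind_diff n (\<lambda>x. \<Sum>i\<in>I. F i x) = (\<lambda>x. \<Sum>i\<in>I. ind_diff n (F i) x)"
proof (induction I rule: infinite_finite_induct)
  case (insert i I)
  then show ?case by (simp add: ind_diff_add)
qed (auto intro: ind_diff_eqI)

lemma sum_fun_apply: "(\<Sum>i\<in>I. f i) x = (\<Sum>i\<in>I. f i x)"
  for f :: "'i \<Rightarrow> 'p \<Rightarrow> 'v::comm_monoid_add"
  by (induction I rule: infinite_finite_induct) simp_all

section \<open>Global sections as binary forms in the second column\<close>

definition column_monomial :: "nat \<Rightarrow> nat \<Rightarrow> 'k::field mat2 \<times> 'k mat2 list \<Rightarrow> 'k" where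
  "column_monomial L j = on_set (GB_points 0) (\<lambda>x. (fst x $ 1 $ 2) ^ (L - j) * (fst x $ 2 $ 2) ^ j)"

lemma column_monomial_cocycle:
  assumes "j \<le> L"
  shows "column_monomial L j \<in> (cochains (int L) 0 :: ('k::field mat2 \<times> 'k mat2 list \<Rightarrow> 'k) set)"
    and "ind_diff 0 (column_monomial L j :: 'k mat2 \<times> 'k mat2 list \<Rightarrow> 'k) = 0"
proof -
  have one: "on_set (GB_points 0) (\<lambda>_. 1 :: 'k) \<in> cochains 0 0"
    by (rule cochainsI)
      (auto simp: mem_GB_points SL2_mult Bneg_SL2 Bneg_mult on_set_def
        intro: polyfuns_on_cong[OF polyfuns_on_const[of 1]])
  have *: "(\<lambda>x. (fst x $ 1 $ 2) ^ (L - j) * ((fst x $ 2 $ 2) ^ j * on_set (GB_points 0) (\<lambda>_. 1 :: 'k) x)) =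
      column_monomial L j"
    by (auto simp: column_monomial_def on_set_def fun_eq_iff)
  show "column_monomial L j \<in> (cochains (int L) 0 :: ('k mat2 \<times> 'k mat2 list \<Rightarrow> 'k) set)"
    using cochains_column[OF cochains_column[OF one, of 2 j], of 1 "L - j"] assms
    unfolding * by (simp add: of_nat_diff)
  show "ind_diff 0 (column_monomial L j :: 'k mat2 \<times> 'k mat2 list \<Rightarrow> 'k) = 0"
  proof (rule ind_diff_eqI)
    fix g :: "'k mat2" and bs assume "(g, bs) \<in> GB_points (Suc 0)"
    then have "(g, omit 0 bs) \<in> GB_points 0" "(g, omit (Suc 0) bs) \<in> GB_points 0"
      using omit_GB_points[of g bs 0] by auto
    then show "(\<Sum>i\<le>Suc 0. (- 1) ^ i * column_monomial L j (g, omit i bs)) = 0 (g, bs)"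
      by (simp add: column_monomial_def sum.atMost_Suc)
  qed simp
qed

text \<open>A 0-cocycle does not depend on b_0, so it is a section f over the projective line. It
  equals u^L p(v/u) where u is nonzero and v^L q(u/v) where v is nonzero, with polynomials p and q.
  The transition p(z) = z^L q(1/z) forces deg p to be at most L.\<close>

lemma cocycles_0_eq:
  fixes F :: "'k::field mat2 \<times> 'k mat2 list \<Rightarrow> 'k"
  assumes inf: "infinite (UNIV :: 'k set)"
    and F: "F \<in> cochains (int L) 0" and cocycle: "ind_diff 0 F = 0"
  shows "\<exists>c. F = (\<lambda>x. \<Sum>j\<le>L. c j * column_monomial L j x)"
proof -
  define f where "f g = F (g, [mat 1])" for g
  have one: "(mat 1 :: 'k mat2) \<in> Bneg"
    by (simp add: Bneg_iff)
  \<comment> \<open>The cocycle condition at the pair (1, b) compares the two faces b and 1.\<close>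
  have Ff: "F (g, [b]) = f g" if "g \<in> SL2" "b \<in> Bneg" for g b
  proof -
    have "(g, [mat 1, b]) \<in> GB_points (Suc 0)"
      using that one by (simp add: mem_GB_points)
    from ind_diff_eq[OF this, of F] show ?thesis
      by (simp add: cocycle f_def sum.atMost_Suc)
  qed
  have f_mult: "f (g ** b) = (b $ 2 $ 2) ^ L * f g" if "g \<in> SL2" "b \<in> Bneg" for g b
    using cochains_equivariant[OF F, of g "[mat 1]" b] that one Ff[of g b]
    by (simp add: f_def mem_GB_points matrix_mul_rid)
  have norm: "f g = (g $ i $ 2) ^ L * f (g ** coset_normalizer i g)" if "g \<in> SL2" "g $ i $ 2 \<noteq> 0" for g i
    using that f_mult[OF that(1) coset_normalizer_Bneg[OF that(2)]]
    by (simp add: coset_normalizer_def power_inverse)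
  have poly_f: "\<exists>P. \<forall>z. f (m z) = poly P z"
    if "\<And>z. m z \<in> SL2" "\<And>i j. \<exists>P. \<forall>z. m z $ i $ j = poly P z" for m
  proof -
    obtain p where p: "p \<in> polyfuns (GB_coords 0)" "\<And>x. x \<in> GB_points 0 \<Longrightarrow> F x = p x"
      using F by (auto simp: cochains_iff polyfuns_on_def)
    have "\<exists>P. \<forall>z. p (m z, [mat 1]) = poly P z"
    proof (rule polyfuns_comp_poly[OF p(1)])
      fix c assume "c \<in> (GB_coords 0 :: ('k mat2 \<times> 'k mat2 list \<Rightarrow> 'k) set)"
      then show "\<exists>P. \<forall>z. c (m z, [mat 1]) = poly P z"
      proof (cases rule: GB_coords_cases)
        case (B l i j)
        then show ?thesis
          by (intro exI[of _ "[:(mat 1 :: 'k mat2) $ i $ j:]"]) simp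
      qed (use that(2) in auto)
    qed
    moreover have "f (m z) = p (m z, [mat 1])" for z
      using that(1) one by (simp add: f_def p(2) mem_GB_points)
    ultimately show ?thesis by simp
  qed
  have ent: "\<exists>P. \<forall>z. mat22 a b c z $ i $ j = poly P z" "\<exists>P. \<forall>z. mat22 a z b c $ i $ j = poly P z"
    for a b c :: 'k and i j :: 2
    using exhaust_2[of i] exhaust_2[of j]
    by (auto intro: exI[of _ "[:0, 1:]"] exI[of _ "[:c:]" for c])
  \<comment> \<open>The two curves consist of the normalized coset representatives over the charts:
    row 1, respectively row 2, is (0, 1).\<close>
  obtain p where p: "\<And>z. f (mat22 0 1 (- 1) z) = poly p z"
    using poly_f[of "\<lambda>z. mat22 0 1 (- 1) z"] ent by (auto simp: SL2_iff)
  obtain q where q: "\<And>z. f (mat22 1 z 0 1) = poly q z"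
    using poly_f[of "\<lambda>z. mat22 1 z 0 1"] ent by (auto simp: SL2_iff)
  have f1: "f g = (g $ 1 $ 2) ^ L * poly p (g $ 2 $ 2 / g $ 1 $ 2)" if "g \<in> SL2" "g $ 1 $ 2 \<noteq> 0" for g
  proof -
    have "g ** coset_normalizer 1 g = mat22 0 1 (- 1) (g $ 2 $ 2 / g $ 1 $ 2)"
      using that by (auto simp: coset_normalizer_def mat2_eq_iff mat2_mult_nth SL2_iff field_simps)
    then show ?thesis
      using norm[of g 1] that by (simp add: p)
  qed
  have f2: "f g = (g $ 2 $ 2) ^ L * poly q (g $ 1 $ 2 / g $ 2 $ 2)" if "g \<in> SL2" "g $ 2 $ 2 \<noteq> 0" for g
  proof -
    have "g ** coset_normalizer 2 g = mat22 1 (g $ 1 $ 2 / g $ 2 $ 2) 0 1"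
      using that by (auto simp: coset_normalizer_def mat2_eq_iff mat2_mult_nth SL2_iff field_simps)
    then show ?thesis
      using norm[of g 2] that by (simp add: q)
  qed
  define D where "D = degree q"
  \<comment> \<open>The transition formula, multiplied by z^D so that both sides are polynomials;
    \<open>reflect_poly q\<close> is z^D q(1/z).\<close>
  have pq: "monom 1 D * p = monom 1 L * reflect_poly q"
  proof (rule poly_eqI_infinite)
    show "infinite (UNIV - {0 :: 'k})"
      using inf by simp
    fix z :: 'k assume z: "z \<in> UNIV - {0}"
    have "poly p z = z ^ L * poly q (1 / z)"
      using f2[of "mat22 0 1 (- 1) z"] z by (simp add: p SL2_iff)
    then show "poly (monom 1 D * p) z = poly (monom 1 L * reflect_poly q) z"
      using z by (simp add: poly_monom poly_reflect_poly_nz D_def field_simps)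
  qed
  have deg: "degree p \<le> L"
  proof (cases "p = 0")
    case False
    then have "D + degree p = degree (monom 1 L * reflect_poly q)"
      using pq by (metis degree_monom_eq degree_mult_eq monom_eq_0_iff one_neq_zero)
    also have "\<dots> \<le> L + D"
      using degree_mult_le[of "monom 1 L" "reflect_poly q"] degree_reflect_poly_le[of q]
      by (simp add: degree_monom_eq D_def)
    finally show ?thesis by simp
  qed simp
  have "coeff p L = coeff (monom 1 D * p) (L + D)"
    by (simp add: coeff_monom_mult)
  also have "\<dots> = coeff q 0"
    unfolding pq by (simp add: coeff_monom_mult coeff_reflect_poly D_def)
  finally have pL: "coeff p L = coeff q 0" .
  have f_eq: "f g = (\<Sum>j\<le>L. coeff p j * ((g $ 1 $ 2) ^ (L - j) * (g $ 2 $ 2) ^ j))" if g: "g \<in> SL2" for g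
  proof (cases "g $ 1 $ 2 = 0")
    case False
    have "poly p (g $ 2 $ 2 / g $ 1 $ 2) = (\<Sum>j\<le>L. coeff p j * (g $ 2 $ 2 / g $ 1 $ 2) ^ j)"
      unfolding poly_altdef
      by (rule sum.mono_neutral_left) (use deg in \<open>auto simp: coeff_eq_0\<close>)
    then show ?thesis
      using f1[OF g False] False
      by (auto simp: sum_distrib_left power_diff power_divide intro!: sum.cong)
  next
    \<comment> \<open>The locus u = 0 lies in the second chart only. There just the summand j = L
      survives, so its coefficient has to be q(0).\<close>
    case True
    with g have nz: "g $ 2 $ 2 \<noteq> 0"
      by (auto simp: SL2_iff)
    have "(\<Sum>j\<le>L. coeff p j * ((g $ 1 $ 2) ^ (L - j) * (g $ 2 $ 2) ^ j)) =
        (\<Sum>j\<in>{L}. coeff p j * ((g $ 1 $ 2) ^ (L - j) * (g $ 2 $ 2) ^ j))"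
      using True by (intro sum.mono_neutral_right) (auto simp: power_0_left)
    then show ?thesis
      using f2[OF g nz] True by (simp add: pL poly_0_coeff_0)
  qed
  show ?thesis
  proof (intro exI[of _ "coeff p"] ext)
    fix x
    show "F x = (\<Sum>j\<le>L. coeff p j * column_monomial L j x)"
    proof (cases "x \<in> GB_points 0")
      case True
      then obtain g b where "x = (g, [b])" "g \<in> SL2" "b \<in> Bneg"
        by (cases x) (auto simp: mem_GB_points length_Suc_conv)
      then show ?thesis
        using True Ff f_eq by (simp add: column_monomial_def)
    next
      case False
      then show ?thesis
        using cochains_outside[OF F] by (simp add: column_monomial_def)
    qed
  qed
qed

text \<open>The long exact sequence of the Koszul sequence
  \<open>0 \<rightarrow> \<L> \<rightarrow> \<L>(N) \<oplus> \<L>(N) \<rightarrow> \<L>(2N) \<rightarrow> 0\<close> of the powers \<open>u\<^sup>N\<close> and \<open>v\<^sup>N\<close>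
  of the entries of the second column: \<open>F\<close> is a coboundary if its images under \<open>u\<^sup>N\<close> and
  \<open>v\<^sup>N\<close> are, and the connecting obstruction vanishes.\<close>

lemma coboundary_from_columns:
  fixes F :: "'k::field mat2 \<times> 'k mat2 list \<Rightarrow> 'k"
  assumes F: "F \<in> cochains w (Suc n)"
    and P: "P \<in> cochains (w + int N) n" "ind_diff n P = (\<lambda>x. (fst x $ 1 $ 2) ^ N * F x)"
    and Q: "Q \<in> cochains (w + int N) n" "ind_diff n Q = (\<lambda>x. (fst x $ 2 $ 2) ^ N * F x)"
    and K: "K \<in> cochains (w + int N) n" "ind_diff n K = 0"
    and L: "L \<in> cochains (w + int N) n" "ind_diff n L = 0"
    and eq: "\<And>x. x \<in> GB_points n \<Longrightarrow> (fst x $ 2 $ 2) ^ N * P x - (fst x $ 1 $ 2) ^ N * Q x =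
      (fst x $ 2 $ 2) ^ N * K x - (fst x $ 1 $ 2) ^ N * L x"
  shows "\<exists>E\<in>cochains w n. ind_diff n E = F"
proof -
  obtain A B where A: "A \<in> cochains (- int N) n" and B: "B \<in> cochains (- int N) n"
    and AB: "\<And>x. x \<in> GB_points n \<Longrightarrow> A x * (fst x $ 2 $ 2 :: 'k) ^ N + B x * (fst x $ 1 $ 2) ^ N = 1"
    using partition_of_unity[of N n N, where ?'k = 'k] by blast
  \<comment> \<open>The solution of u^N E = P - K and v^N E = Q - L. The two equations are
    compatible by \<open>eq\<close>, and the partition of unity solves them without
    denominators.\<close>
  define E where "E = (\<lambda>x. A x * (Q x - L x) + B x * (P x - K x))"
  have E: "E \<in> cochains w n"
    using cochains_mult[OF A cochains_diff[OF Q(1) L(1)]] cochains_mult[OF B cochains_diff[OF P(1) K(1)]]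
    unfolding E_def by (intro cochains_add) simp_all
  have eq': "(fst x $ 2 $ 2) ^ N * (P x - K x) = (fst x $ 1 $ 2) ^ N * (Q x - L x)" if "x \<in> GB_points n" for x
    using eq[OF that] by (simp add: algebra_simps)
  have uE: "(fst x $ 1 $ 2) ^ N * E x = P x - K x" and vE: "(fst x $ 2 $ 2) ^ N * E x = Q x - L x"
    if x: "x \<in> GB_points n" for x
  proof -
    have "(fst x $ 1 $ 2) ^ N * E x = A x * ((fst x $ 1 $ 2) ^ N * (Q x - L x)) + B x * (fst x $ 1 $ 2) ^ N * (P x - K x)"
      by (simp add: E_def algebra_simps)
    also have "\<dots> = (A x * (fst x $ 2 $ 2) ^ N + B x * (fst x $ 1 $ 2) ^ N) * (P x - K x)"
      by (simp only: eq'[OF x, symmetric]) (simp add: algebra_simps)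
    finally show "(fst x $ 1 $ 2) ^ N * E x = P x - K x"
      by (simp add: AB[OF x])
    have "(fst x $ 2 $ 2) ^ N * E x = A x * (fst x $ 2 $ 2) ^ N * (Q x - L x) + B x * ((fst x $ 2 $ 2) ^ N * (P x - K x))"
      by (simp add: E_def algebra_simps)
    also have "\<dots> = (A x * (fst x $ 2 $ 2) ^ N + B x * (fst x $ 1 $ 2) ^ N) * (Q x - L x)"
      by (simp only: eq'[OF x]) (simp add: algebra_simps)
    finally show "(fst x $ 2 $ 2) ^ N * E x = Q x - L x"
      by (simp add: AB[OF x])
  qed
  have dE: "(\<lambda>x. (fst x $ i $ 2) ^ N * ind_diff n E x) = (\<lambda>x. (fst x $ i $ 2) ^ N * F x)" for i
  proof -
    consider "i = 1" | "i = 2" using exhaust_2[of i] by auto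
    then show ?thesis
    proof cases
      case 1
      have "ind_diff n (\<lambda>x. (fst x $ 1 $ 2) ^ N * E x) = ind_diff n (\<lambda>x. P x - K x)"
        by (rule ind_diff_cong) (rule uE)
      then show ?thesis
        by (simp add: 1 ind_diff_mult_G[of n "\<lambda>g. (g $ 1 $ 2) ^ N"] ind_diff_diff P K)
    next
      case 2
      have "ind_diff n (\<lambda>x. (fst x $ 2 $ 2) ^ N * E x) = ind_diff n (\<lambda>x. Q x - L x)"
        by (rule ind_diff_cong) (rule vE)
      then show ?thesis
        by (simp add: 2 ind_diff_mult_G[of n "\<lambda>g. (g $ 2 $ 2) ^ N"] ind_diff_diff Q L)
    qed
  qed
  have "ind_diff n E x = F x" for x
  proof (cases "x \<in> GB_points (Suc n)")
    case True
    then have "fst x \<in> SL2"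
      by (auto simp: GB_points_def)
    \<comment> \<open>The equation dE = F is known after multiplication by u^N and by v^N; u and v
      never vanish together, so one factor can be cancelled.\<close>
    then have "fst x $ 1 $ 2 \<noteq> 0 \<or> fst x $ 2 $ 2 \<noteq> 0"
      by (auto simp: SL2_iff)
    then show ?thesis
      using fun_cong[OF dE[of 1], of x] fun_cong[OF dE[of 2], of x] by auto
  next
    case False
    then show ?thesis
      by (simp add: ind_diff_outside cochains_outside[OF F])
  qed
  with E show ?thesis by blast
qed

lemma cocycle_is_coboundary:
  fixes F :: "'k::field mat2 \<times> 'k mat2 list \<Rightarrow> 'k"
  assumes inf: "infinite (UNIV :: 'k set)" and w: "w \<ge> 0"
    and F: "F \<in> cochains w (Suc n)" and cocycle: "ind_diff (Suc n) F = 0"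
  shows "\<exists>E\<in>cochains w n. ind_diff n E = F"
proof -
  obtain N1 N2 where N1: "\<And>N. N \<ge> N1 \<Longrightarrow> \<exists>P\<in>cochains (w + int N) n.
      ind_diff n P = (\<lambda>x. (fst x $ 1 $ 2) ^ N * F x)"
    and N2: "\<And>N. N \<ge> N2 \<Longrightarrow> \<exists>P\<in>cochains (w + int N) n.
      ind_diff n P = (\<lambda>x. (fst x $ 2 $ 2) ^ N * F x)"
    using cocycle_times_column_power[OF F cocycle] by meson
  define N where "N = max N1 N2"
  obtain P Q where P: "P \<in> cochains (w + int N) n" "ind_diff n P = (\<lambda>x. (fst x $ 1 $ 2) ^ N * F x)"
    and Q: "Q \<in> cochains (w + int N) n" "ind_diff n Q = (\<lambda>x. (fst x $ 2 $ 2) ^ N * F x)"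
    using N1[of N] N2[of N] by (auto simp: N_def)
  \<comment> \<open>The connecting obstruction: both terms have differential u^N v^N F.\<close>
  define Z where "Z = (\<lambda>x. (fst x $ 2 $ 2) ^ N * P x - (fst x $ 1 $ 2) ^ N * Q x)"
  have Z: "Z \<in> cochains (w + 2 * int N) n"
    using cochains_column[OF P(1), of 2 N] cochains_column[OF Q(1), of 1 N]
    unfolding Z_def by (intro cochains_diff) (simp_all add: algebra_simps)
  have dZ: "ind_diff n Z = 0"
    unfolding Z_def
    by (simp add: ind_diff_diff ind_diff_mult_G[of n "\<lambda>g. (g $ 1 $ 2) ^ N"]
        ind_diff_mult_G[of n "\<lambda>g. (g $ 2 $ 2) ^ N"] P Q fun_eq_iff)
  show ?thesis
  proof (cases n)
    case 0
    define L where "L = nat w + 2 * N"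
    have intL: "int L = w + 2 * int N"
      using w by (simp add: L_def)
    then obtain c where c: "Z = (\<lambda>x. \<Sum>j\<le>L. c j * column_monomial L j x)"
      using cocycles_0_eq[OF inf, of Z L] Z dZ 0 by auto
    have cm: "column_monomial (L - N) j \<in> cochains (w + int N) 0" "ind_diff 0 (column_monomial (L - N) j) = 0"
      if "j \<le> L - N" for j
    proof -
      have "int (L - N) = w + int N"
        using w by (simp add: L_def)
      then show "column_monomial (L - N) j \<in> cochains (w + int N) 0"
        using column_monomial_cocycle(1)[OF that] by metis
      show "ind_diff 0 (column_monomial (L - N) j) = 0"
        by (rule column_monomial_cocycle(2)[OF that])
    qed
    \<comment> \<open>Monomials u^(L - j) v^j with j at least N are divisible by v^N. For j < N the
      other exponent exceeds N, as L is at least 2N. The minus sign in K' fits the form v^N K - u^N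
      K'.\<close>
    define K where "K = (\<lambda>x. \<Sum>j\<in>{N..L}. c j * column_monomial (L - N) (j - N) x)"
    define K' where "K' = (\<lambda>x. \<Sum>j\<in>{..<N}. - c j * column_monomial (L - N) j x)"
    have K: "K \<in> cochains (w + int N) 0" "ind_diff 0 K = 0"
      unfolding K_def ind_diff_sum ind_diff_scale fun_eq_iff
      by (auto simp: cm diff_le_mono intro!: cochains_sum cochains_scale sum.neutral)
    have le: "j \<le> L - N" if "j < N" for j
      using that by (simp add: L_def)
    have K': "K' \<in> cochains (w + int N) 0" "ind_diff 0 K' = 0"
      unfolding K'_def ind_diff_sum ind_diff_scale fun_eq_iff
      using le by (auto simp: cm simp del: mult_minus_left
          intro!: cochains_sum cochains_minus cochains_scale sum.neutral)
    have "Z x = (fst x $ 2 $ 2) ^ N * K x - (fst x $ 1 $ 2) ^ N * K' x" if x: "x \<in> GB_points 0" for x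
    proof -
      have *: "{..L} = {N..L} \<union> {..<N}"
        by (auto simp: L_def)
      have "Z x = (\<Sum>j\<in>{N..L}. c j * column_monomial L j x) + (\<Sum>j\<in>{..<N}. c j * column_monomial L j x)"
        unfolding c * by (rule sum.union_disjoint) auto
      also have "(\<Sum>j\<in>{N..L}. c j * column_monomial L j x) = (fst x $ 2 $ 2) ^ N * K x"
        unfolding K_def sum_distrib_left
        by (rule sum.cong) (auto simp: column_monomial_def x mult_ac simp flip: power_add)
      also have "(\<Sum>j\<in>{..<N}. c j * column_monomial L j x) = - ((fst x $ 1 $ 2) ^ N * K' x)"
      proof -
        have "(fst x $ 1 $ 2) ^ (L - j) = (fst x $ 1 $ 2) ^ N * (fst x $ 1 $ 2) ^ (L - N - j)" if "j < N" for j
        proof -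
          have "L - j = N + (L - N - j)"
            using that by (simp add: L_def)
          then show ?thesis
            by (simp only: power_add)
        qed
        then show ?thesis
          unfolding K'_def sum_distrib_left sum_negf[symmetric]
          by (intro sum.cong) (auto simp: column_monomial_def x)
      qed
      finally show ?thesis by simp
    qed
    then show ?thesis
      using coboundary_from_columns[OF F P Q, of K K'] K K' 0 unfolding Z_def by auto
  next
    case (Suc m)
    obtain M where "\<exists>K\<in>cochains (w + 2 * int N + int M) m. ind_diff m K = (\<lambda>x. (fst x $ 1 $ 2) ^ M * Z x)"
      using cocycle_times_column_power[of Z "w + 2 * int N" m 1] Z dZ unfolding Suc by blast
    then obtain K where K: "K \<in> cochains (w + 2 * int N + int M) m"
      "ind_diff m K = (\<lambda>x. (fst x $ 1 $ 2) ^ M * Z x)"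
      by blast
    \<comment> \<open>The homotopy bounds u^M Z; the further factor v^M makes the bounded cocycle
      (uv)^M Z. That is the obstruction belonging to the exponent N + M.\<close>
    define K' where "K' = (\<lambda>x. (fst x $ 2 $ 2) ^ M * K x)"
    have K': "K' \<in> cochains (w + int (N + M) + int (N + M)) m"
      using cochains_column[OF K(1), of 2 M] unfolding K'_def by (simp add: algebra_simps)
    have dK': "ind_diff m K' = (\<lambda>x. (fst x $ 2 $ 2) ^ M * ((fst x $ 1 $ 2) ^ M * Z x))"
      unfolding K'_def by (simp add: ind_diff_mult_G[of m "\<lambda>g. (g $ 2 $ 2) ^ M"] K)
    obtain A B where A: "A \<in> cochains (- int (N + M)) m" and B: "B \<in> cochains (- int (N + M)) m"
      and AB: "\<And>x. x \<in> GB_points m \<Longrightarrow>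
        A x * (fst x $ 2 $ 2 :: 'k) ^ (N + M) + B x * (fst x $ 1 $ 2) ^ (N + M) = 1"
      using partition_of_unity[of "N + M" m "N + M", where ?'k = 'k] by blast
    \<comment> \<open>The partition of unity gives K' = v^(N+M) U - u^(N+M) V. Applying d turns U
      and V into the cocycles by which the primitives are corrected.\<close>
    define U where "U = (\<lambda>x. A x * K' x)"
    define V where "V = (\<lambda>x. - (B x * K' x))"
    have U: "U \<in> cochains (w + int (N + M)) m" and V: "V \<in> cochains (w + int (N + M)) m"
      using cochains_mult[OF A K'] cochains_minus[OF cochains_mult[OF B K']]
      unfolding U_def V_def by (simp_all add: algebra_simps)
    have "ind_diff m K' = ind_diff m (\<lambda>x. (fst x $ 2 $ 2) ^ (N + M) * U x - (fst x $ 1 $ 2) ^ (N + M) * V x)"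
    proof (rule ind_diff_cong)
      fix x :: "'k mat2 \<times> 'k mat2 list" assume x: "x \<in> GB_points m"
      have "(fst x $ 2 $ 2) ^ (N + M) * U x - (fst x $ 1 $ 2) ^ (N + M) * V x =
          (A x * (fst x $ 2 $ 2) ^ (N + M) + B x * (fst x $ 1 $ 2) ^ (N + M)) * K' x"
        by (simp add: U_def V_def algebra_simps)
      then show "K' x = (fst x $ 2 $ 2) ^ (N + M) * U x - (fst x $ 1 $ 2) ^ (N + M) * V x"
        by (simp only: AB[OF x] mult_1_left)
    qed
    also have "\<dots> = (\<lambda>x. (fst x $ 2 $ 2) ^ (N + M) * ind_diff m U x - (fst x $ 1 $ 2) ^ (N + M) * ind_diff m V x)"
      by (simp only: ind_diff_diff ind_diff_mult_G[of m "\<lambda>g. (g $ 1 $ 2) ^ (N + M)"]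
        ind_diff_mult_G[of m "\<lambda>g. (g $ 2 $ 2) ^ (N + M)"])
    finally have split: "(fst x $ 2 $ 2) ^ M * ((fst x $ 1 $ 2) ^ M * Z x) =
        (fst x $ 2 $ 2) ^ (N + M) * ind_diff m U x - (fst x $ 1 $ 2) ^ (N + M) * ind_diff m V x" for x
      by (metis dK')
    \<comment> \<open>Primitives of u^(N+M) F and v^(N+M) F, matching the enlarged exponent.\<close>
    define P' where "P' = (\<lambda>x. (fst x $ 1 $ 2) ^ M * P x)"
    define Q' where "Q' = (\<lambda>x. (fst x $ 2 $ 2) ^ M * Q x)"
    have "P' \<in> cochains (w + int (N + M)) n" "Q' \<in> cochains (w + int (N + M)) n"
      using cochains_column[OF P(1), of 1 M] cochains_column[OF Q(1), of 2 M]
      unfolding P'_def Q'_def by (simp_all add: algebra_simps)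
    moreover have "ind_diff n P' = (\<lambda>x. (fst x $ 1 $ 2) ^ (N + M) * F x)"
      "ind_diff n Q' = (\<lambda>x. (fst x $ 2 $ 2) ^ (N + M) * F x)"
      unfolding P'_def Q'_def ind_diff_mult_G[of n "\<lambda>g. (g $ 1 $ 2) ^ M"]
        ind_diff_mult_G[of n "\<lambda>g. (g $ 2 $ 2) ^ M"] P(2) Q(2)
      by (simp_all add: power_add mult_ac)
    moreover have "ind_diff m U \<in> cochains (w + int (N + M)) n" "ind_diff m V \<in> cochains (w + int (N + M)) n"
      "ind_diff n (ind_diff m U) = 0" "ind_diff n (ind_diff m V) = 0"
      using U V by (auto simp: Suc ind_diff_cochains ind_diff_ind_diff)
    moreover have "(fst x $ 2 $ 2) ^ (N + M) * P' x - (fst x $ 1 $ 2) ^ (N + M) * Q' x =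
        (fst x $ 2 $ 2) ^ (N + M) * ind_diff m U x - (fst x $ 1 $ 2) ^ (N + M) * ind_diff m V x" for x
      unfolding split[symmetric] by (simp add: P'_def Q'_def Z_def power_add algebra_simps)
    ultimately show ?thesis
      by (intro coboundary_from_columns[OF F, of P' "N + M" Q' "ind_diff m U" "ind_diff m V"]) auto
  qed
qed

text \<open>Only H^0 survives, the space of binary forms of degree L. Left translation evaluates at
  the inverse of the torus element, which scales u by s^-1 and v by s. Hence u^(L - j) v^j has
  weight j - (L - j).\<close>

lemma chi_nonneg_weight:
  assumes inf: "infinite (UNIV :: 'k::field set)"
  shows "chi TYPE('k) (int L) = Abs_poly_mapping (\<lambda>l. int (card {j. j \<le> L \<and> 2 * int j - int L = l}))"
proof -
  let ?sc = "(*) :: 'k \<Rightarrow> 'k \<Rightarrow> 'k" and ?rho = "\<lambda>b z. (b $ 1 $ 1 :: 'k) powi int L * z"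
  let ?V = "ind_cocycles ?sc ?rho 0"
  have vs: "vector_space (fun_scale ?sc)"
    by (rule fun_space.vector_space_axioms)
  have higher: "ch_H ?sc ?rho (Suc i) = 0" for i
    unfolding ch_H_def
  proof (rule ch_eq_0[OF vs])
    show "ind_cocycles ?sc ?rho (Suc i) \<subseteq> ind_coboundaries ?sc ?rho (Suc i)"
      using cocycle_is_coboundary[OF inf, of "int L" _ i]
      by (fastforce simp: ind_cocycles_def ind_coboundaries_def cochains_def)
  qed
  have V_iff: "F \<in> ?V \<longleftrightarrow> F \<in> cochains (int L) 0 \<and> ind_diff 0 F = 0" for F
    by (simp only: ind_cocycles_def cochains_def mem_Collect_eq)
  have Veq: "?V = range (\<lambda>c x. \<Sum>j\<in>{..L}. c j * column_monomial L j x)"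
  proof
    show "?V \<subseteq> range (\<lambda>c x. \<Sum>j\<in>{..L}. c j * column_monomial L j x)"
      using cocycles_0_eq[OF inf] unfolding V_iff subset_iff image_def by blast
    show "range (\<lambda>c x. \<Sum>j\<in>{..L}. c j * column_monomial L j x) \<subseteq> ?V"
      unfolding V_iff subset_iff
      by (auto simp: ind_diff_sum ind_diff_scale column_monomial_cocycle fun_eq_iff
          intro!: cochains_sum cochains_scale)
  qed
  have fs: "(\<Sum>j\<in>{..L}. fun_scale ?sc (c j) (column_monomial L j)) = (\<lambda>x. \<Sum>j\<in>{..L}. c j * column_monomial L j x)" for c
    by (auto simp: fun_scale_def fun_eq_iff sum_fun_apply)
  have Veq': "?V = range (\<lambda>c. \<Sum>j\<in>{..L}. fun_scale ?sc (c j) (column_monomial L j))"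
    unfolding fs by (rule Veq)
  have act: "left_translation (torus s) (\<lambda>x. \<Sum>j\<in>{..L}. c j * column_monomial L j x) =
      (\<lambda>x. \<Sum>j\<in>{..L}. (s powi (2 * int j - int L) * c j) * column_monomial L j x)" if s: "s \<noteq> 0" for s :: 'k and c
  proof
    fix x :: "'k mat2 \<times> 'k mat2 list"
    obtain g bs where x: "x = (g, bs)" by (cases x)
    note inv = torus_inverse[OF s]
    have "det (matrix_inv (torus s) ** g) = det g"
      using SL2_inverse_SL2[OF torus_SL2[OF s]] by (simp add: SL2_def det_mul)
    then have pt: "(matrix_inv (torus s) ** g, bs) \<in> GB_points 0 \<longleftrightarrow> (g, bs) \<in> GB_points 0"
      by (simp add: mem_GB_points SL2_def)
    have "column_monomial L j (matrix_inv (torus s) ** g, bs) =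
        s powi (2 * int j - int L) * column_monomial L j (g, bs)" if j: "j \<le> L" for j
    proof (cases "(g, bs) \<in> GB_points 0")
      case True
      have "s powi (2 * int j - int L) = s powi (int j - int (L - j))"
        using j by (simp add: of_nat_diff)
      also have "\<dots> = inverse s ^ (L - j) * s ^ j"
        using s by (simp add: power_int_diff field_simps)
      finally show ?thesis
        using True pt by (simp add: column_monomial_def inv mat2_mult_nth power_mult_distrib)
    next
      case False
      with pt show ?thesis by (simp add: column_monomial_def)
    qed
    then show "left_translation (torus s) (\<lambda>x. \<Sum>j\<in>{..L}. c j * column_monomial L j x) x =
        (\<Sum>j\<in>{..L}. (s powi (2 * int j - int L) * c j) * column_monomial L j x)"
      by (simp add: left_translation_def x mult.left_commute mult.assoc)
  qed
  have "ch_H ?sc ?rho 0 = Abs_poly_mapping (\<lambda>l. int (card {j \<in> {..L}. 2 * int j - int L = l}))"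
    unfolding ch_H_def
  \<comment> \<open>There are no nonzero coboundaries in degree 0, so the identity serves as the map
    with kernel W.\<close>
  proof (rule ch_eq_weight_multiplicities[OF inf, where f = "\<lambda>F. F" and ?s2.0 = "fun_scale ?sc"
        and e = "column_monomial L"])
    show "Vector_Spaces.linear (fun_scale ?sc) (fun_scale ?sc) (\<lambda>F :: 'k mat2 \<times> 'k mat2 list \<Rightarrow> 'k. F)"
      by (rule linear_fun_scaleI) auto
    show "fun_space.subspace ?V"
    proof (rule fun_space.subspaceI)
      show "0 \<in> ?V"
        unfolding Veq by (rule range_eqI[of _ _ "\<lambda>_. 0"]) (simp add: fun_eq_iff)
      show "F + G \<in> ?V" if "F \<in> ?V" "G \<in> ?V" for F G
        using that unfolding V_iff plus_fun_def by (simp add: cochains_add ind_diff_add fun_eq_iff)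
      show "fun_scale ?sc c F \<in> ?V" if "F \<in> ?V" for c F
        using that unfolding V_iff fun_scale_def by (simp add: cochains_scale ind_diff_scale fun_eq_iff)
    qed
    show "ind_coboundaries ?sc ?rho 0 = {v \<in> ?V. v = 0}"
      using Veq by (auto simp: ind_coboundaries_def fun_eq_iff intro!: range_eqI[of _ _ "\<lambda>_. 0"])
    show "finite {..L}" by simp
    show "\<forall>j\<in>{..L}. c j = 0" if "(\<Sum>j\<in>{..L}. fun_scale ?sc (c j) (column_monomial L j)) = 0" for c
    proof
      fix i assume i: "i \<in> {..L}"
      have "(\<Sum>j\<in>{..L}. c j * z ^ j) = 0" for z
      proof -
        \<comment> \<open>On this curve u = 1 and v = z, so the j-th basis form becomes z^j.\<close>
        have pt: "(mat22 0 1 (- 1) z, [mat 1]) \<in> GB_points 0"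
          by (simp add: mem_GB_points SL2_iff Bneg_iff)
        show ?thesis
          using fun_cong[OF that[unfolded fs], of "(mat22 0 1 (- 1) z, [mat 1])"] pt
          by (simp add: column_monomial_def)
      qed
      from sum_monom_eq_zeroD[OF inf _ this i] show "c i = 0" by simp
    qed
    show "(\<lambda>F. F) ` ?V = range (\<lambda>c. \<Sum>j\<in>{..L}. fun_scale ?sc (c j) (column_monomial L j))"
      by (simp only: image_ident Veq')
    show "left_translation (torus s) F \<in> ?V" if "s \<noteq> 0" "F \<in> ?V" for s F
      using that(2) act[OF that(1)] unfolding Veq by auto
    show "left_translation (torus s) F = (\<Sum>j\<in>{..L}. fun_scale ?sc (s powi (2 * int j - int L) * c j) (column_monomial L j))"
      if "s \<noteq> 0" "F \<in> ?V" "F = (\<Sum>j\<in>{..L}. fun_scale ?sc (c j) (column_monomial L j))" for s F c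
      unfolding that(3) fs by (rule act[OF that(1)])
  qed
  moreover have "chi TYPE('k) (int L) = ch_H ?sc ?rho 0"
  proof -
    have "chi TYPE('k) (int L) = (\<Sum>i\<in>{0}. (- 1) ^ i * ch_H ?sc ?rho i)"
      unfolding chi_def euler_char_def
    proof (rule Sum_any.expand_superset)
      have "(- 1) ^ i * ch_H ?sc ?rho i = 0" if "i \<noteq> 0" for i
        using higher that by (cases i) auto
      then show "{i. (- 1) ^ i * ch_H ?sc ?rho i \<noteq> 0} \<subseteq> {0}"
        by blast
    qed simp
    then show ?thesis by simp
  qed
  ultimately show ?thesis by simp
qed

section \<open>The coordinate ring of the nilpotent commuting variety\<close>

text \<open>The matrix is c times the column (x, y) times the row (y, -x): its image and kernel are
  both spanned by (x, y) when c, (x, y) are nonzero. Entries are linear in c and quadratic in (x,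
  y), which is the source of the exponents 2n below.\<close>

definition cone_tuple :: "'k::field \<Rightarrow> 'k \<Rightarrow> 'k list \<Rightarrow> 'k mat2 list" where
  "cone_tuple x y cs = map (\<lambda>c. mat22 (c * (x * y)) (- (c * (x * x))) (c * (y * y)) (- (c * (x * y)))) cs"

lemma length_cone_tuple [simp]: "length (cone_tuple x y cs) = length cs"
  by (simp add: cone_tuple_def)

lemma cone_tuple_nth:
  assumes "l < length cs"
  shows "cone_tuple x y cs ! l $ 1 $ 1 = cs ! l * (x * y)" "cone_tuple x y cs ! l $ 1 $ 2 = - (cs ! l * (x * x))"
    "cone_tuple x y cs ! l $ 2 $ 1 = cs ! l * (y * y)" "cone_tuple x y cs ! l $ 2 $ 2 = - (cs ! l * (x * y))"
  using assms by (simp_all add: cone_tuple_def)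

lemma sl2_iff: "X \<in> sl2 \<longleftrightarrow> X $ 1 $ 1 + X $ 2 $ 2 = 0"
  by (simp add: sl2_def trace_def sum_2)

lemma cone_tuple_sl2: "set (cone_tuple x y cs) \<subseteq> sl2"
  by (auto simp: cone_tuple_def sl2_iff)

text \<open>A vanishing power forces det X = 0, the exponent 0 being impossible as the identity has
  determinant 1. With trace 0 this becomes the equation of the cone.\<close>

lemma nilpotent_coneD:
  assumes "X \<in> nilpotent_cone"
  shows "X $ 2 $ 2 = - X $ 1 $ 1" "X $ 1 $ 1 * X $ 1 $ 1 + X $ 1 $ 2 * X $ 2 $ 1 = 0"
proof -
  have sl: "X $ 1 $ 1 + X $ 2 $ 2 = 0"
    using assms by (simp add: nilpotent_cone_def sl2_iff)
  then show tr: "X $ 2 $ 2 = - X $ 1 $ 1"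
    by (simp add: add_eq_0_iff)
  obtain m where m: "((\<lambda>Y. X ** Y) ^^ m) (mat 1) = 0"
    using assms by (auto simp: nilpotent_cone_def)
  have "det (((\<lambda>Y. X ** Y) ^^ m) (mat 1)) = det X ^ m" for m
    by (induction m) (simp_all add: det_mul)
  then have "det X ^ m = 0"
    using m by (metis det_2 diff_self mult_zero_left zero_index)
  then have "det X = 0"
    by (cases "m = 0") auto
  then show "X $ 1 $ 1 * X $ 1 $ 1 + X $ 1 $ 2 * X $ 2 $ 1 = 0"
    by (simp add: det_2 tr add_eq_0_iff)
qed

text \<open>A nilpotent matrix commuting with a nonzero nilpotent X is a multiple of X. Entry (1,2)
  of the commutator yields this relation multiplied by 2, which is where the characteristic is used.
  Scaling is left to the parameters c, so the direction can be taken as (1, y) or (0, 1) and no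
  square roots occur.\<close>

lemma nilpotent_commuting_variety_eq:
  assumes two: "(2 :: 'k::field) \<noteq> 0"
  shows "(nilpotent_commuting_variety r :: 'k mat2 list set) = {cone_tuple x y cs | x y cs. length cs = r}"
proof (intro set_eqI iffI)
  fix vs :: "'k mat2 list" assume "vs \<in> {cone_tuple x y cs | x y cs. length cs = r}"
  then obtain x y cs where vs: "vs = cone_tuple x y cs" and len: "length cs = r" by auto
  have "X \<in> nilpotent_cone" if X: "X \<in> set vs" for X
  proof -
    obtain c where c: "X = mat22 (c * (x * y)) (- (c * (x * x))) (c * (y * y)) (- (c * (x * y)))"
      using X by (auto simp: vs cone_tuple_def)
    have "X ** (X ** mat 1) = 0"
      by (simp add: mat2_eq_iff mat2_mult_nth c algebra_simps)
    then have "((\<lambda>Y. X ** Y) ^^ 2) (mat 1) = 0"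
      by (simp add: numeral_2_eq_2)
    moreover have "X \<in> sl2"
      by (simp add: sl2_iff c)
    ultimately show ?thesis
      unfolding nilpotent_cone_def by blast
  qed
  moreover have "vs ! i ** vs ! j - vs ! j ** vs ! i = 0" if "i < r" "j < r" for i j
    using that len by (simp add: mat2_eq_iff mat2_mult_nth vs cone_tuple_nth algebra_simps)
  ultimately show "vs \<in> nilpotent_commuting_variety r"
    using len by (auto simp: nilpotent_commuting_variety_def vs)
next
  fix vs :: "'k mat2 list" assume vs: "vs \<in> nilpotent_commuting_variety r"
  have len: "length vs = r" and nil: "\<And>X. X \<in> set vs \<Longrightarrow> X \<in> nilpotent_cone"
    using vs by (auto simp: nilpotent_commuting_variety_def)
  have comm: "X ** Y = Y ** X" if "X \<in> set vs" "Y \<in> set vs" for X Y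
    using vs that unfolding nilpotent_commuting_variety_def
    by (auto simp: in_set_conv_nth)
  have "\<exists>x y. \<forall>X\<in>set vs. \<exists>c. X = mat22 (c * (x * y)) (- (c * (x * x))) (c * (y * y)) (- (c * (x * y)))"
  proof (cases "\<exists>X\<in>set vs. X $ 1 $ 2 \<noteq> 0")
    case True
    then obtain X where X: "X \<in> set vs" "X $ 1 $ 2 \<noteq> 0" by blast
    \<comment> \<open>For direction (1, y) the first row is c (y, -1), whence the quotient.\<close>
    define y where "y = - X $ 1 $ 1 / X $ 1 $ 2"
    have X11: "X $ 1 $ 1 = - y * X $ 1 $ 2"
      using X by (simp add: y_def)
    have X21: "X $ 2 $ 1 = - y * y * X $ 1 $ 2"
    proof -
      have "X $ 1 $ 2 * X $ 2 $ 1 = X $ 1 $ 2 * (- y * y * X $ 1 $ 2)"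
        using nilpotent_coneD(2)[OF nil[OF X(1)]] unfolding X11 by (simp add: algebra_simps add_eq_0_iff)
      then show ?thesis
        using X(2) by (metis mult_left_cancel)
    qed
    have "\<exists>c. Y = mat22 (c * (1 * y)) (- (c * (1 * 1))) (c * (y * y)) (- (c * (1 * y)))" if Y: "Y \<in> set vs" for Y
    proof -
      note Y1 = nilpotent_coneD[OF nil[OF Y]]
      note X1 = nilpotent_coneD[OF nil[OF X(1)]]
      have "(X ** Y) $ 1 $ 1 = (Y ** X) $ 1 $ 1" "(X ** Y) $ 1 $ 2 = (Y ** X) $ 1 $ 2"
        using comm[OF X(1) Y] by simp_all
      then have e1: "X $ 1 $ 2 * Y $ 2 $ 1 = Y $ 1 $ 2 * X $ 2 $ 1"
        and e2: "2 * (X $ 1 $ 1 * Y $ 1 $ 2) = 2 * (X $ 1 $ 2 * Y $ 1 $ 1)"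
        by (simp_all add: mat2_mult_nth X1(1) Y1(1) algebra_simps)
      have "X $ 1 $ 2 * Y $ 2 $ 1 = X $ 1 $ 2 * (- y * y * Y $ 1 $ 2)"
        using e1 unfolding X21 by (simp add: algebra_simps)
      then have 21: "Y $ 2 $ 1 = - y * y * Y $ 1 $ 2"
        using X(2) by (metis mult_left_cancel)
      have "X $ 1 $ 2 * Y $ 1 $ 1 = X $ 1 $ 2 * (- y * Y $ 1 $ 2)"
        using e2 two unfolding X11 mult_left_cancel[OF two] by (simp add: algebra_simps)
      then have 11: "Y $ 1 $ 1 = - y * Y $ 1 $ 2"
        using X(2) by (metis mult_left_cancel)
      show ?thesis
        by (rule exI[of _ "- Y $ 1 $ 2"]) (simp add: mat2_eq_iff Y1(1) 21 11 mult_ac)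
    qed
    then show ?thesis by blast
  next
    \<comment> \<open>With all (1,2) entries zero, the cone equation kills the diagonals as well,
      and every matrix has direction (0, 1).\<close>
    case False
    have "\<exists>c. Y = mat22 (c * (0 * 1)) (- (c * (0 * 0))) (c * (1 * 1)) (- (c * (0 * 1)))" if Y: "Y \<in> set vs" for Y
      using False Y nilpotent_coneD[OF nil[OF Y]]
      by (intro exI[of _ "Y $ 2 $ 1"]) (simp add: mat2_eq_iff)
    then show ?thesis by blast
  qed
  then obtain x y c where c: "\<And>X. X \<in> set vs \<Longrightarrow>
      X = mat22 (c X * (x * y)) (- (c X * (x * x))) (c X * (y * y)) (- (c X * (x * y)))"
    by metis
  have "vs = cone_tuple x y (map c vs)"
    unfolding cone_tuple_def map_map o_def using c by (metis (no_types, lifting) map_idI)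
  then show "vs \<in> {cone_tuple x y cs | x y cs. length cs = r}"
    using len by (metis (mono_tags, lifting) length_map mem_Collect_eq)
qed

section \<open>Pullback to the parameters of the cone\<close>

definition cone_pullback :: "nat \<Rightarrow> ('k::field mat2 list \<Rightarrow> 'k) \<Rightarrow> 'k \<times> 'k \<times> 'k list \<Rightarrow> 'k" where
  "cone_pullback r f = (\<lambda>(x, y, cs). if length cs = r then f (cone_tuple x y cs) else 0)"

lemma linear_cone_pullback:
  "Vector_Spaces.linear (fun_scale ((*) :: 'k::field \<Rightarrow> _)) (fun_scale (*)) (cone_pullback r)"
  by (rule linear_fun_scaleI) (auto simp: cone_pullback_def fun_scale_def fun_eq_iff)

text \<open>The parametrization is onto the variety, so a function vanishes there exactly when its
  pullback is zero.\<close>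

lemma commuting_ideal_eq_kernel:
  assumes "(2 :: 'k::field) \<noteq> 0"
  shows "commuting_ideal r n = {f \<in> sl2_polys r n. cone_pullback r f = (0 :: _ \<Rightarrow> 'k)}"
  unfolding commuting_ideal_def nilpotent_commuting_variety_eq[OF assms]
  by (auto simp: cone_pullback_def fun_eq_iff)

definition cone_monomial :: "nat \<Rightarrow> nat \<Rightarrow> nat \<times> nat list \<Rightarrow> 'k::field \<times> 'k \<times> 'k list \<Rightarrow> 'k" where
  "cone_monomial r n = (\<lambda>(i, a) (x, y, cs).
    if length cs = r then x ^ (2 * n - i) * y ^ i * (\<Prod>l<r. cs ! l ^ (a ! l)) else 0)"

definition compositions :: "nat \<Rightarrow> nat \<Rightarrow> nat list set" where
  "compositions r n = {a. length a = r \<and> sum_list a = n}"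

lemma finite_compositions: "finite (compositions r n)"
proof (rule finite_subset)
  show "compositions r n \<subseteq> {a. set a \<subseteq> {..n} \<and> length a = r}"
    using member_le_sum_list by (fastforce simp: compositions_def)
  show "finite {a. set a \<subseteq> {..n} \<and> length a = r}"
    by (rule finite_lists_length_eq) simp
qed

text \<open>Induction on the number of variables. With the other variables fixed, grouping exponent
  vectors by first entry gives a one-variable polynomial with no nonzero values; each coefficient
  vanishes and is a relation in one variable less.\<close>

lemma power_products_independent:
  fixes c :: "nat list \<Rightarrow> 'k::field"
  assumes inf: "infinite (UNIV :: 'k set)"
  shows "finite E \<Longrightarrow> (\<And>e. e \<in> E \<Longrightarrow> length e = m) \<Longrightarrow>
    (\<And>z. length z = m \<Longrightarrow> (\<Sum>e\<in>E. c e * (\<Prod>l<m. z ! l ^ (e ! l))) = 0) \<Longrightarrow> e \<in> E \<Longrightarrow> c e = 0"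
proof (induction m arbitrary: E c e)
  case 0
  then have "E = {[]}" by auto
  with 0(3)[of "[]"] 0(4) show ?case by simp
next
  case (Suc m)
  obtain d e' where e: "e = d # e'"
    using Suc.prems(2,4) by (metis length_Suc_conv)
  define E' where "E' = {e \<in> E. hd e = d}"
  have E': "x = d # tl x" if "x \<in> E'" for x
    using that Suc.prems(2)[of x] by (cases x) (auto simp: E'_def)
  have inj: "inj_on tl E'"
    by (rule inj_onI) (metis E')
  have "(\<Sum>x\<in>tl ` E'. c (d # x) * (\<Prod>l<m. z ! l ^ (x ! l))) = 0" if z: "length z = m" for z
  proof -
    have step: "(\<Prod>l<Suc m. (t # z) ! l ^ (x ! l)) = t ^ hd x * (\<Prod>l<m. z ! l ^ (tl x ! l))"
      if "x \<in> E" for x t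
      using Suc.prems(2)[OF that]
      by (cases x) (auto simp: prod.lessThan_Suc_shift simp del: prod.lessThan_Suc)
    have "(\<Sum>k\<in>hd ` E. (\<Sum>x\<in>{x \<in> E. hd x = k}. c x * (\<Prod>l<m. z ! l ^ (tl x ! l))) * t ^ k) = 0" for t
    proof -
      have "(\<Sum>k\<in>hd ` E. (\<Sum>x\<in>{x \<in> E. hd x = k}. c x * (\<Prod>l<m. z ! l ^ (tl x ! l))) * t ^ k) =
          (\<Sum>k\<in>hd ` E. \<Sum>x\<in>{x \<in> E. hd x = k}. c x * (\<Prod>l<Suc m. (t # z) ! l ^ (x ! l)))"
        unfolding sum_distrib_right by (intro sum.cong refl) (auto simp only: step mem_Collect_eq mult_ac)
      also have "\<dots> = (\<Sum>x\<in>E. c x * (\<Prod>l<Suc m. (t # z) ! l ^ (x ! l)))"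
        using Suc.prems(1) by (rule sum.image_gen[symmetric])
      also have "\<dots> = 0"
        using z by (intro Suc.prems(3)) simp
      finally show ?thesis .
    qed
    moreover have "d \<in> hd ` E"
      using Suc.prems(4) e by force
    ultimately have "(\<Sum>x\<in>E'. c x * (\<Prod>l<m. z ! l ^ (tl x ! l))) = 0"
      unfolding E'_def using Suc.prems(1)
      by (intro sum_monom_eq_zeroD[OF inf, of "hd ` E" "\<lambda>k. \<Sum>x\<in>{x \<in> E. hd x = k}. c x * (\<Prod>l<m. z ! l ^ (tl x ! l))" d]) auto
    also have "(\<Sum>x\<in>E'. c x * (\<Prod>l<m. z ! l ^ (tl x ! l))) =
        (\<Sum>x\<in>E'. c (d # tl x) * (\<Prod>l<m. z ! l ^ (tl x ! l)))"
      using E' by (intro sum.cong) auto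
    finally show ?thesis
      by (simp add: sum.reindex[OF inj])
  qed
  moreover have "finite (tl ` E')" "e' \<in> tl ` E'"
    using Suc.prems(1,4) e by (auto simp: E'_def image_iff intro!: bexI[of _ e])
  moreover have "length x = m" if "x \<in> tl ` E'" for x
    using that Suc.prems(2) by (auto simp: E'_def)
  ultimately show ?case
    unfolding e by (intro Suc.IH[of "tl ` E'" "\<lambda>x. c (d # x)"]) auto
qed

text \<open>Setting x = 1 loses nothing, since the total degree in x and y is fixed; (i, a) becomes
  the exponent vector \<open>i # a\<close> in y and the parameters c.\<close>

lemma cone_monomials_independent:
  fixes c :: "nat \<times> nat list \<Rightarrow> 'k::field"
  assumes inf: "infinite (UNIV :: 'k set)"
    and zero: "(\<Sum>p\<in>{..2 * n} \<times> compositions r n. fun_scale (*) (c p) (cone_monomial r n p)) = 0"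
  shows "\<forall>p\<in>{..2 * n} \<times> compositions r n. c p = 0"
proof
  let ?I = "{..2 * n} \<times> compositions r n" and ?h = "\<lambda>(i, a). i # a"
  fix p assume p: "p \<in> ?I"
  have inj: "inj_on ?h ?I"
    by (auto simp: inj_on_def)
  define c' where "c' e = c (hd e, tl e)" for e
  have "c' (?h p) = 0"
  proof (rule power_products_independent[OF inf, of "?h ` ?I" "Suc r" c' "?h p"])
    show "finite (?h ` ?I)"
      using finite_compositions by auto
    show "length e = Suc r" if "e \<in> ?h ` ?I" for e
      using that by (auto simp: compositions_def)
    show "?h p \<in> ?h ` ?I" using p by (rule imageI)
    fix z :: "'k list" assume "length z = Suc r"
    then obtain y cs where z: "z = y # cs" "length cs = r"
      by (auto simp: length_Suc_conv)
    have "(\<Sum>e\<in>?h ` ?I. c' e * (\<Prod>l<Suc r. z ! l ^ (e ! l))) =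
        (\<Sum>q\<in>?I. c q * cone_monomial r n q (1, y, cs))"
      by (subst sum.reindex[OF inj], rule sum.cong)
        (auto simp: z c'_def cone_monomial_def prod.lessThan_Suc_shift simp del: prod.lessThan_Suc)
    also have "\<dots> = 0"
      using fun_cong[OF zero, of "(1, y, cs)"] by (simp add: sum_fun_apply fun_scale_def)
    finally show "(\<Sum>e\<in>?h ` ?I. c' e * (\<Prod>l<Suc r. z ! l ^ (e ! l))) = 0" .
  qed
  then show "c p = 0"
    by (cases p) (simp add: c'_def)
qed

abbreviation sl2_coords :: "nat \<Rightarrow> ('k::field mat2 list \<Rightarrow> 'k) set" where
  "sl2_coords r \<equiv> {\<lambda>vs. vs ! l $ i $ j | l i j. l < r}"

abbreviation sl2_tuples :: "nat \<Rightarrow> 'k::field mat2 list set" where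
  "sl2_tuples r \<equiv> {vs. length vs = r \<and> set vs \<subseteq> sl2}"

lemma prod_power_list_update:
  fixes cs :: "'k::comm_monoid_mult list"
  assumes "l < r" "length a = r"
  shows "(\<Prod>k<r. cs ! k ^ (a[l := Suc (a ! l)] ! k)) = cs ! l * (\<Prod>k<r. cs ! k ^ (a ! k))"
proof -
  have "(\<Prod>k<r. cs ! k ^ (a[l := Suc (a ! l)] ! k)) =
      cs ! l ^ Suc (a ! l) * (\<Prod>k\<in>{..<r} - {l}. cs ! k ^ (a ! k))"
    using assms by (subst prod.remove[of _ l]) (auto intro!: prod.cong)
  also have "\<dots> = cs ! l * (\<Prod>k<r. cs ! k ^ (a ! k))"
    using assms by (subst (2) prod.remove[of _ l]) (auto simp: mult_ac)
  finally show ?thesis .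
qed

text \<open>Each matrix entry is, up to sign, c_l times one of x^2, xy, y^2. The scalar \<kappa>
  collects the signs.\<close>

lemma coordinate_monomial_on_cone:
  assumes "set zs \<subseteq> (sl2_coords r :: ('k::field mat2 list \<Rightarrow> 'k) set)"
  shows "\<exists>\<kappa>. \<exists>p\<in>{..2 * length zs} \<times> compositions r (length zs). \<forall>x y cs. length cs = r \<longrightarrow>
    (\<Prod>c\<leftarrow>zs. c (cone_tuple x y cs)) = \<kappa> * cone_monomial r (length zs) p (x, y, cs)"
  using assms
proof (induction zs)
  case Nil
  have "(0, replicate r 0) \<in> {..2 * (0 :: nat)} \<times> compositions r 0"
    by (simp add: compositions_def)
  then show ?case
    by (intro exI[of _ 1] bexI[of _ "(0, replicate r 0)"]) (auto simp: cone_monomial_def)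
next
  case (Cons z zs)
  let ?n = "length zs"
  obtain \<kappa> i a where i: "i \<le> 2 * ?n" and a: "a \<in> compositions r ?n"
    and IH: "\<And>x y cs. length cs = r \<Longrightarrow>
      (\<Prod>c\<leftarrow>zs. c (cone_tuple x y cs)) = \<kappa> * cone_monomial r ?n (i, a) (x, y, cs)"
    using Cons by auto
  obtain l s t where l: "l < r" and z: "z = (\<lambda>vs. vs ! l $ s $ t)"
    using Cons.prems by auto
  have "\<exists>\<mu> e. e \<le> 2 \<and> (\<forall>x y cs. length cs = r \<longrightarrow> z (cone_tuple x y cs) = \<mu> * (cs ! l * (x ^ (2 - e) * y ^ e)))"
  proof -
    consider "s = 1" "t = 1" | "s = 1" "t = 2" | "s = 2" "t = 1" | "s = 2" "t = 2"
      using exhaust_2[of s] exhaust_2[of t] by blast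
    then show ?thesis
    proof cases
      case 1
      then show ?thesis
        using l by (intro exI[of _ 1] exI[of _ 1]) (simp add: z cone_tuple_nth)
    next
      case 2
      then show ?thesis
        using l by (intro exI[of _ "- 1"] exI[of _ 0]) (simp add: z cone_tuple_nth power2_eq_square)
    next
      case 3
      then show ?thesis
        using l by (intro exI[of _ 1] exI[of _ 2]) (simp add: z cone_tuple_nth power2_eq_square)
    next
      case 4
      then show ?thesis
        using l by (intro exI[of _ "- 1"] exI[of _ 1]) (simp add: z cone_tuple_nth)
    qed
  qed
  then obtain \<mu> e where e: "e \<le> 2"
    and ze: "\<And>x y cs. length cs = r \<Longrightarrow> z (cone_tuple x y cs) = \<mu> * (cs ! l * (x ^ (2 - e) * y ^ e))"
    by blast
  let ?a = "a[l := Suc (a ! l)]"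
  have la: "length a = r" using a by (simp add: compositions_def)
  have mem: "(i + e, ?a) \<in> {..2 * length (z # zs)} \<times> compositions r (length (z # zs))"
    using i e a l la by (simp add: compositions_def sum_list_update)
  have "(\<Prod>c\<leftarrow>z # zs. c (cone_tuple x y cs)) =
      (\<mu> * \<kappa>) * cone_monomial r (length (z # zs)) (i + e, ?a) (x, y, cs)" if cs: "length cs = r" for x y cs
  proof -
    have "2 * length (z # zs) - (i + e) = (2 - e) + (2 * ?n - i)"
      using i e by simp
    then show ?thesis
      using cs by (simp add: ze IH cone_monomial_def prod_power_list_update[OF l la] power_add mult_ac)
  qed
  with mem show ?case by blast
qed

text \<open>Every monomial of degree 2n in x and y is a product of n factors x^2, xy, y^2. Splitting
  off one of them together with some available c_l amounts to splitting off one matrix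
  entry.\<close>

lemma cone_monomial_from_coordinates:
  "i \<le> 2 * n \<Longrightarrow> a \<in> compositions r n \<Longrightarrow> \<exists>zs. length zs = n \<and>
    set zs \<subseteq> (sl2_coords r :: ('k::field mat2 list \<Rightarrow> 'k) set) \<and> (\<exists>\<kappa>. \<forall>x y cs. length cs = r \<longrightarrow>
      cone_monomial r n (i, a) (x, y, cs) = \<kappa> * (\<Prod>c\<leftarrow>zs. c (cone_tuple x y cs)))"
proof (induction n arbitrary: i a)
  case 0
  then have "\<And>l. l < r \<Longrightarrow> a ! l = 0"
    by (auto simp: compositions_def)
  then show ?case
    using 0 by (intro exI[of _ "[]"] conjI exI[of _ 1]) (auto simp: cone_monomial_def)
next
  case (Suc n)
  have la: "length a = r" and sa: "sum_list a = Suc n"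
    using Suc.prems by (auto simp: compositions_def)
  have "\<exists>l<r. a ! l \<noteq> 0"
    using sa la by (metis in_set_conv_nth nat.distinct(1) sum_list_eq_0_iff)
  then obtain l where l: "l < r" "a ! l \<noteq> 0"
    by blast
  define b where "b = a[l := a ! l - 1]"
  have ab: "a = b[l := Suc (b ! l)]" and lb: "length b = r"
    using l la by (auto simp: b_def)
  have b: "b \<in> compositions r n"
    using l la sa lb by (simp add: compositions_def b_def sum_list_update member_le_sum_list)
  \<comment> \<open>The greedy choice: removing as many factors y as possible keeps the remaining
    exponent i - e within 2n.\<close>
  define e where "e = min 2 i"
  have e: "e \<le> 2" "e \<le> i" "i - e \<le> 2 * n"
    using Suc.prems(1) by (auto simp: e_def)
  obtain zs \<kappa> where zs: "length zs = n" "set zs \<subseteq> (sl2_coords r :: ('k mat2 list \<Rightarrow> 'k) set)"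
    and \<kappa>: "\<And>x y cs. length cs = r \<Longrightarrow>
      cone_monomial r n (i - e, b) (x, y, cs) = \<kappa> * (\<Prod>c\<leftarrow>zs. c (cone_tuple x y cs))"
    using Suc.IH[OF e(3) b] by blast
  have "\<exists>z\<in>sl2_coords r. \<exists>\<mu> :: 'k. \<forall>x y cs. length cs = r \<longrightarrow>
      cs ! l * (x ^ (2 - e) * y ^ e) = \<mu> * z (cone_tuple x y cs)"
  proof -
    consider "e = 0" | "e = 1" | "e = 2" using e(1) by linarith
    then show ?thesis
    proof cases
      case 1
      then show ?thesis
        using l by (intro bexI[of _ "\<lambda>vs. vs ! l $ 1 $ 2"] exI[of _ "- 1"])
          (auto simp: cone_tuple_nth power2_eq_square)
    next
      case 2
      then show ?thesis
        using l by (intro bexI[of _ "\<lambda>vs. vs ! l $ 1 $ 1"] exI[of _ 1]) (auto simp: cone_tuple_nth)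
    next
      case 3
      then show ?thesis
        using l by (intro bexI[of _ "\<lambda>vs. vs ! l $ 2 $ 1"] exI[of _ 1])
          (auto simp: cone_tuple_nth power2_eq_square)
    qed
  qed
  then obtain z \<mu> where z: "z \<in> sl2_coords r"
    and \<mu>: "\<And>x y cs. length cs = r \<Longrightarrow> cs ! l * (x ^ (2 - e) * y ^ e) = \<mu> * z (cone_tuple x y cs :: 'k mat2 list)"
    by blast
  have "cone_monomial r (Suc n) (i, a) (x, y, cs) = (\<mu> * \<kappa>) * (\<Prod>c\<leftarrow>z # zs. c (cone_tuple x y cs))"
    if cs: "length cs = r" for x y cs
  proof -
    have i: "2 * Suc n - i = (2 - e) + (2 * n - (i - e))" "i = e + (i - e)"
      using e Suc.prems(1) by (auto simp: e_def)
    have "cone_monomial r (Suc n) (i, a) (x, y, cs) =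
        x ^ ((2 - e) + (2 * n - (i - e))) * y ^ (e + (i - e)) * (cs ! l * (\<Prod>k<r. cs ! k ^ (b ! k)))"
      using cs i prod_power_list_update[OF l(1) lb, of cs] ab by (simp add: cone_monomial_def)
    also have "\<dots> = (cs ! l * (x ^ (2 - e) * y ^ e)) * cone_monomial r n (i - e, b) (x, y, cs)"
      using cs by (simp only: power_add cone_monomial_def) (simp add: mult_ac)
    finally show ?thesis
      by (simp add: \<mu>[OF cs] \<kappa>[OF cs])
  qed
  then show ?case
    using z zs by (intro exI[of _ "z # zs"]) auto
qed

lemma sl2_polys_eq: "sl2_polys r n = on_set (sl2_tuples r) ` fun_space.span (monomial_funs (sl2_coords r) n)"
  unfolding sl2_polys_def homogeneous_maps_eq ..

lemma subspace_sl2_polys: "fun_space.subspace (sl2_polys r n)"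
  unfolding sl2_polys_def homogeneous_maps_def by (rule fun_space.subspace_span)

lemma cone_pullback_image:
  "cone_pullback r ` sl2_polys r n =
    fun_space.span (cone_monomial r n ` ({..2 * n} \<times> compositions r n) :: ('k::field \<times> 'k \<times> 'k list \<Rightarrow> 'k) set)"
    (is "_ = fun_space.span ?E")
proof -
  interpret f: Vector_Spaces.linear "fun_scale ((*) :: 'k \<Rightarrow> _)" "fun_scale (*)"
    "\<lambda>F. cone_pullback r (on_set (sl2_tuples r) F)"
    using Vector_Spaces.linear_compose[OF linear_on_set linear_cone_pullback] by (simp add: o_def)
  have pb: "cone_pullback r (on_set (sl2_tuples r) F) = (\<lambda>(x, y, cs). if length cs = r then F (cone_tuple x y cs) else 0)"
    for F :: "'k mat2 list \<Rightarrow> 'k"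
    by (auto simp: cone_pullback_def on_set_def fun_eq_iff dest: subsetD[OF cone_tuple_sl2])
  have "(cone_pullback r ` sl2_polys r n :: ('k \<times> 'k \<times> 'k list \<Rightarrow> 'k) set) =
      fun_space.span ((\<lambda>F. cone_pullback r (on_set (sl2_tuples r) F)) ` monomial_funs (sl2_coords r) n)"
    unfolding sl2_polys_eq f.span_image by (simp add: image_image)
  also have "\<dots> = fun_space.span ?E"
  proof
    have "cone_pullback r (on_set (sl2_tuples r) m) \<in> fun_space.span ?E"
      if m: "m \<in> monomial_funs (sl2_coords r) n" for m
    proof -
      obtain zs where zs: "m = (\<lambda>vs. \<Prod>c\<leftarrow>zs. c vs)" "length zs = n" "set zs \<subseteq> sl2_coords r"
        using m by (rule monomial_funsE)
      obtain \<kappa> p where p: "p \<in> {..2 * n} \<times> compositions r n"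
        "\<And>x y cs. length cs = r \<Longrightarrow> (\<Prod>c\<leftarrow>zs. c (cone_tuple x y cs)) = \<kappa> * cone_monomial r n p (x, y, cs)"
        using coordinate_monomial_on_cone[OF zs(3)] unfolding zs(2) by blast
      have "cone_pullback r (on_set (sl2_tuples r) m) = fun_scale (*) \<kappa> (cone_monomial r n p)"
        unfolding pb zs(1) fun_scale_def using p(2)
        by (auto simp: fun_eq_iff cone_monomial_def split: prod.splits)
      then show ?thesis
        using p(1) by (auto intro: fun_space.span_scale fun_space.span_base)
    qed
    then show "fun_space.span ((\<lambda>F. cone_pullback r (on_set (sl2_tuples r) F)) ` monomial_funs (sl2_coords r) n)
        \<subseteq> fun_space.span ?E"
      by (intro fun_space.span_minimal) auto
    have "(cone_monomial r n p :: 'k \<times> 'k \<times> 'k list \<Rightarrow> 'k) \<in>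
        fun_space.span ((\<lambda>F. cone_pullback r (on_set (sl2_tuples r) F)) ` monomial_funs (sl2_coords r) n)"
      if p: "p \<in> {..2 * n} \<times> compositions r n" for p
    proof -
      obtain i a where ia: "p = (i, a)" "i \<le> 2 * n" "a \<in> compositions r n"
        using p by auto
      obtain zs \<kappa> where zs: "length zs = n" "set zs \<subseteq> (sl2_coords r :: ('k mat2 list \<Rightarrow> 'k) set)"
        "\<And>x y cs. length cs = r \<Longrightarrow> cone_monomial r n (i, a) (x, y, cs) = \<kappa> * (\<Prod>c\<leftarrow>zs. c (cone_tuple x y cs))"
        using cone_monomial_from_coordinates[OF ia(2,3)] by blast
      have m: "(\<lambda>vs. \<Prod>c\<leftarrow>zs. c vs) \<in> monomial_funs (sl2_coords r) n"
        using zs unfolding monomial_funs_def by blast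
      have eq: "cone_monomial r n p = fun_scale (*) \<kappa> (cone_pullback r (on_set (sl2_tuples r) (\<lambda>vs. \<Prod>c\<leftarrow>zs. c vs)))"
        unfolding pb ia(1) fun_scale_def
      proof
        fix q :: "'k \<times> 'k \<times> 'k list"
        obtain x y cs where q: "q = (x, y, cs)" by (cases q)
        show "cone_monomial r n (i, a) q =
            \<kappa> * (case q of (x, y, cs) \<Rightarrow> if length cs = r then \<Prod>c\<leftarrow>zs. c (cone_tuple x y cs) else 0)"
        proof (cases "length cs = r")
          case True
          then show ?thesis by (simp add: q zs(3))
        next
          case False
          then show ?thesis by (simp add: q cone_monomial_def)
        qed
      qed
      show ?thesis
        unfolding eq by (intro fun_space.span_scale fun_space.span_base imageI m)
    qed
    then show "fun_space.span ?E \<subseteq>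
        fun_space.span ((\<lambda>F. cone_pullback r (on_set (sl2_tuples r) F)) ` monomial_funs (sl2_coords r) n)"
      by (intro fun_space.span_minimal) auto
  qed
  finally show ?thesis .
qed

section \<open>The torus action in the parameters\<close>

lemma torus_conjugate_nth:
  assumes "s \<noteq> 0"
  shows "(matrix_inv (torus s) ** X ** torus s) $ 1 $ 1 = X $ 1 $ 1"
    "(matrix_inv (torus s) ** X ** torus s) $ 1 $ 2 = inverse s * inverse s * X $ 1 $ 2"
    "(matrix_inv (torus s) ** X ** torus s) $ 2 $ 1 = s * s * X $ 2 $ 1"
    "(matrix_inv (torus s) ** X ** torus s) $ 2 $ 2 = X $ 2 $ 2"
  unfolding torus_inverse[OF assms] using assms by (simp_all add: mat2_mult_nth torus_eq)

text \<open>Conjugation by the torus multiplies each matrix entry by a scalar, so coordinate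
  monomials are eigenvectors. It preserves trace zero in both directions and is thus compatible with
  extension by zero.\<close>

lemma sl2_polys_torus_stable:
  fixes s :: "'k::field"
  assumes s: "s \<noteq> 0" and f: "f \<in> sl2_polys r n"
  shows "adjoint_action (torus s) f \<in> sl2_polys r n"
proof -
  let ?X = "sl2_tuples r :: 'k mat2 list set" and ?M = "monomial_funs (sl2_coords r :: ('k mat2 list \<Rightarrow> 'k) set) n"
  define conj where "conj = map (\<lambda>X. matrix_inv (torus s) ** X ** torus s)"
  have conjX: "conj vs \<in> ?X \<longleftrightarrow> vs \<in> ?X" for vs
    by (auto simp: conj_def sl2_iff torus_conjugate_nth[OF s] subset_iff)
  interpret T: Vector_Spaces.linear "fun_scale ((*) :: 'k \<Rightarrow> _)" "fun_scale (*)"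
    "\<lambda>F. on_set ?X (\<lambda>vs. F (conj vs))"
    by (rule linear_fun_scaleI) (auto simp: on_set_def fun_scale_def fun_eq_iff)
  have mono: "\<exists>\<kappa>. \<forall>vs\<in>?X. (\<Prod>c\<leftarrow>zs. c (conj vs)) = \<kappa> * (\<Prod>c\<leftarrow>zs. c vs)"
    if "set zs \<subseteq> sl2_coords r" for zs :: "('k mat2 list \<Rightarrow> 'k) list"
    using that
  proof (induction zs)
    case Nil
    show ?case by (intro exI[of _ 1]) simp
  next
    case (Cons z zs)
    then obtain \<kappa> where \<kappa>: "\<forall>vs\<in>?X. (\<Prod>c\<leftarrow>zs. c (conj vs)) = \<kappa> * (\<Prod>c\<leftarrow>zs. c vs)"
      by auto
    obtain l i j where l: "l < r" and z: "z = (\<lambda>vs. vs ! l $ i $ j)"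
      using Cons.prems by auto
    have "\<exists>\<mu>. \<forall>vs\<in>?X. z (conj vs) = \<mu> * z vs"
    proof -
      have nth: "conj vs ! l = matrix_inv (torus s) ** (vs ! l) ** torus s" if "vs \<in> ?X" for vs
        using that l by (simp add: conj_def)
      have 1: "\<exists>\<mu>. \<forall>vs\<in>?X. vs ! l $ a $ b = \<mu> * vs ! l $ a $ b" for a b
        by (rule exI[of _ 1]) simp
      show ?thesis
        using exhaust_2[of i] exhaust_2[of j] 1
        by (elim disjE) (auto simp: z nth torus_conjugate_nth[OF s])
    qed
    then obtain \<mu> where \<mu>: "\<forall>vs\<in>?X. z (conj vs) = \<mu> * z vs" by blast
    show ?case
      using \<kappa> \<mu> by (intro exI[of _ "\<mu> * \<kappa>"]) auto
  qed
  have "on_set ?X (\<lambda>vs. m (conj vs)) \<in> sl2_polys r n" if m: "m \<in> ?M" for m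
  proof -
    obtain zs where zs: "m = (\<lambda>vs. \<Prod>c\<leftarrow>zs. c vs)" "length zs = n" "set zs \<subseteq> sl2_coords r"
      using m by (rule monomial_funsE)
    obtain \<kappa> where \<kappa>: "\<forall>vs\<in>?X. (\<Prod>c\<leftarrow>zs. c (conj vs)) = \<kappa> * (\<Prod>c\<leftarrow>zs. c vs)"
      using mono[OF zs(3)] by blast
    have "on_set ?X (\<lambda>vs. m (conj vs)) = on_set ?X (fun_scale (*) \<kappa> m)"
    proof
      fix vs
      show "on_set ?X (\<lambda>vs. m (conj vs)) vs = on_set ?X (fun_scale (*) \<kappa> m) vs"
      proof (cases "vs \<in> ?X")
        case True
        then show ?thesis
          using bspec[OF \<kappa> True] by (simp only: on_set_in fun_scale_def zs(1))
      qed (simp only: on_set_notin not_False_eq_True)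
    qed
    moreover have "fun_scale (*) \<kappa> m \<in> fun_space.span ?M"
      using m by (intro fun_space.span_scale fun_space.span_base)
    ultimately show ?thesis
      unfolding sl2_polys_eq by (rule image_eqI)
  qed
  then have "(\<lambda>F. on_set ?X (\<lambda>vs. F (conj vs))) ` fun_space.span ?M \<subseteq> sl2_polys r n"
    unfolding T.span_image[symmetric]
    by (intro fun_space.span_minimal subspace_sl2_polys) auto
  moreover obtain F where F: "f = on_set ?X F" "F \<in> fun_space.span ?M"
    using f unfolding sl2_polys_eq by blast
  moreover have "adjoint_action (torus s) f = on_set ?X (\<lambda>vs. F (conj vs))"
  proof
    fix vs
    have "adjoint_action (torus s) f vs = f (conj vs)"
      by (simp add: adjoint_action_def conj_def)
    also have "\<dots> = on_set ?X (\<lambda>vs. F (conj vs)) vs"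
      unfolding F(1) on_set_def using conjX[of vs] by simp
    finally show "adjoint_action (torus s) f vs = on_set ?X (\<lambda>vs. F (conj vs)) vs" .
  qed
  ultimately show ?thesis by auto
qed

text \<open>Conjugating the rank one matrix by h in \<open>SL2\<close> applies h to the vector (x,
  y); here h is the inverse torus element. So x and y scale exactly as the second column of g does
  under left translation, which is why the weights on the two sides agree.\<close>

lemma cone_pullback_adjoint_torus:
  assumes "s \<noteq> 0"
  shows "cone_pullback r (adjoint_action (torus s) f) (x, y, cs) = cone_pullback r f (inverse s * x, s * y, cs)"
proof -
  have "map (\<lambda>X. matrix_inv (torus s) ** X ** torus s) (cone_tuple x y cs) = cone_tuple (inverse s * x) (s * y) cs"
    using assms by (auto simp: cone_tuple_def mat2_eq_iff torus_conjugate_nth)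
  then show ?thesis
    by (simp add: cone_pullback_def adjoint_action_def)
qed

lemma cone_monomial_torus:
  assumes "s \<noteq> 0" "i \<le> 2 * n"
  shows "cone_monomial r n (i, a) (inverse s * x, s * y, cs) =
    s powi (2 * int i - int (2 * n)) * cone_monomial r n (i, a) (x, y, cs)"
proof -
  have "s powi (2 * int i - int (2 * n)) = s powi (int i - int (2 * n - i))"
    using assms(2) by (simp add: of_nat_diff)
  also have "\<dots> = inverse s ^ (2 * n - i) * s ^ i"
    using assms(1) by (simp add: power_int_diff field_simps)
  finally show ?thesis
    by (simp add: cone_monomial_def power_mult_distrib)
qed

lemma ch_commuting:
  assumes inf: "infinite (UNIV :: 'k::field set)" and two: "(2 :: 'k) \<noteq> 0"
  shows "ch (fun_scale (*)) adjoint_action (sl2_polys r n :: ('k mat2 list \<Rightarrow> 'k) set) (commuting_ideal r n) =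
    Abs_poly_mapping (\<lambda>l. int (card {p \<in> {..2 * n} \<times> compositions r n. 2 * int (fst p) - int (2 * n) = l}))"
proof (rule ch_eq_weight_multiplicities[OF inf linear_cone_pullback[of r] subspace_sl2_polys
      commuting_ideal_eq_kernel[OF two], where e = "cone_monomial r n"])
  let ?I = "{..2 * n} \<times> compositions r n"
  show fin: "finite ?I"
    using finite_compositions by auto
  show ind: "\<forall>p\<in>?I. c p = 0" if "(\<Sum>p\<in>?I. fun_scale (*) (c p) (cone_monomial r n p)) = 0" for c :: "_ \<Rightarrow> 'k"
    using cone_monomials_independent[OF inf that] .
  show "cone_pullback r ` sl2_polys r n = range (\<lambda>c :: _ \<Rightarrow> 'k. \<Sum>p\<in>?I. fun_scale (*) (c p) (cone_monomial r n p))"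
    unfolding cone_pullback_image by (rule fun_space.independent_family(3)[OF fin ind]) auto
  show "adjoint_action (torus s) f \<in> sl2_polys r n" if "s \<noteq> 0" "f \<in> sl2_polys r n" for s :: 'k and f
    using that by (rule sl2_polys_torus_stable)
  show "cone_pullback r (adjoint_action (torus s) f) =
      (\<Sum>p\<in>?I. fun_scale (*) (s powi (2 * int (fst p) - int (2 * n)) * c p) (cone_monomial r n p))"
    if s: "s \<noteq> 0" and f: "cone_pullback r f = (\<Sum>p\<in>?I. fun_scale (*) (c p) (cone_monomial r n p))"
    for s :: 'k and f c
  proof
    fix q :: "'k \<times> 'k \<times> 'k list"
    obtain x y cs where q: "q = (x, y, cs)" by (cases q)
    have "cone_pullback r (adjoint_action (torus s) f) q = (\<Sum>p\<in>?I. c p * cone_monomial r n p (inverse s * x, s * y, cs))"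
      by (simp add: q cone_pullback_adjoint_torus[OF s] f sum_fun_apply fun_scale_def)
    also have "\<dots> = (\<Sum>p\<in>?I. s powi (2 * int (fst p) - int (2 * n)) * c p * cone_monomial r n p q)"
    proof (rule sum.cong[OF refl])
      fix p assume "p \<in> ?I"
      then obtain i a where p: "p = (i, a)" "i \<le> 2 * n" by auto
      show "c p * cone_monomial r n p (inverse s * x, s * y, cs) =
          s powi (2 * int (fst p) - int (2 * n)) * c p * cone_monomial r n p q"
        unfolding p(1) q fst_conv cone_monomial_torus[OF s p(2)] by (simp only: mult_ac)
    qed
    finally show "cone_pullback r (adjoint_action (torus s) f) q =
        (\<Sum>p\<in>?I. fun_scale (*) (s powi (2 * int (fst p) - int (2 * n)) * c p) (cone_monomial r n p)) q"
      by (simp add: sum_fun_apply fun_scale_def)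
  qed
qed

lemma lookup_Abs_card_fibre:
  assumes "finite I"
  shows "Poly_Mapping.lookup (Abs_poly_mapping (\<lambda>l. int (card {p \<in> I. w p = l}))) l = int (card {p \<in> I. w p = l})"
proof -
  have "finite {l. int (card {p \<in> I. w p = l}) \<noteq> 0}"
    by (rule finite_subset[of _ "w ` I"]) (use assms in \<open>auto simp: card_eq_0_iff\<close>)
  then show ?thesis
    by (subst lookup_Abs_poly_mapping) auto
qed

theorem theorem5p4p2:
  fixes r :: nat
  assumes "CHAR('k::alg_closed_field) \<noteq> 2"
    and "r > 0"
  shows "ch_t_commuting TYPE('k) r =
    Abs_fps (\<lambda>n. \<Sum>a \<in> {a :: nat list. length a = r \<and> sum_list a = n}.
      chi TYPE('k) (int n * pos_root))"
proof -
  note inf = infinite_UNIV_alg_closed[where ?'k = 'k]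
  have two: "(2 :: 'k) \<noteq> 0"
  proof
    assume "(2 :: 'k) = 0"
    then have "CHAR('k) dvd 2"
      by (metis of_nat_eq_0_iff_char_dvd of_nat_numeral)
    then have "CHAR('k) = 1"
      using assms(1) by (metis prime_nat_iff two_is_prime_nat)
    then show False
      using of_nat_CHAR[where ?'a = 'k] by simp
  qed
  have "ch (fun_scale (*)) adjoint_action (sl2_polys r n :: ('k mat2 list \<Rightarrow> 'k) set) (commuting_ideal r n) =
      (\<Sum>a\<in>compositions r n. chi TYPE('k) (int n * pos_root))" for n
  proof (rule poly_mapping_eqI)
    fix l
    \<comment> \<open>The weight depends on i alone, so each weight multiplicity is that of the
      Euler characteristic times the number of exponent vectors a.\<close>
    have "{p \<in> {..2 * n} \<times> compositions r n. 2 * int (fst p) - int (2 * n) = l} =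
        {j \<in> {..2 * n}. 2 * int j - int (2 * n) = l} \<times> compositions r n"
      by auto
    then have 1: "Poly_Mapping.lookup (ch (fun_scale (*)) adjoint_action (sl2_polys r n :: ('k mat2 list \<Rightarrow> 'k) set) (commuting_ideal r n)) l =
        int (card {j \<in> {..2 * n}. 2 * int j - int (2 * n) = l} * card (compositions r n))"
      unfolding ch_commuting[OF inf two]
      by (subst lookup_Abs_card_fibre) (simp_all only: finite_cartesian_product finite_compositions
          finite_atMost card_cartesian_product)
    have "chi TYPE('k) (int n * pos_root) =
        Abs_poly_mapping (\<lambda>l. int (card {j \<in> {..2 * n}. 2 * int j - int (2 * n) = l}))"
      using chi_nonneg_weight[OF inf, of "2 * n"] by (simp add: pos_root_def mult.commute)
    then have 2: "Poly_Mapping.lookup (chi TYPE('k) (int n * pos_root)) l = int (card {j \<in> {..2 * n}. 2 * int j - int (2 * n) = l})"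
      by (simp only: lookup_Abs_card_fibre finite_atMost)
    show "Poly_Mapping.lookup (ch (fun_scale (*)) adjoint_action (sl2_polys r n :: ('k mat2 list \<Rightarrow> 'k) set) (commuting_ideal r n)) l =
        Poly_Mapping.lookup (\<Sum>a\<in>compositions r n. chi TYPE('k) (int n * pos_root)) l"
      unfolding 1 lookup_sum 2 by (simp only: sum_constant of_nat_mult mult.commute)
  qed
  then show ?thesis
    unfolding ch_t_commuting_def ch_t_def compositions_def by simp
qed

end
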